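(* Let $G$ be a graph and $s,t$ vertices of $G$ at distance $k$, and let $G'$ be the graph constructed from $(G,s,t)$ as in the context. Then there is a polynomial-time computable bijection $\varphi$ from the set of shortest $(s,t)$-paths of $G$ to the set of independent sets of size $k+1$ of $G'$ such that, for any two shortest $(s,t)$-paths $P,Q$, mapping a sequence $(P_0,\dots,P_r)$ to $(\varphi(P_0),\dots,\varphi(P_r))$ gives a length-preserving bijection between shortest reconfiguration sequences from $P$ to $Q$ in the shortest path reconfiguration graph of $G$ and shortest reconfiguration sequences from $\varphi(P)$ to $\varphi(Q)$ in the TS-graph of $G'$, and likewise in the TJ-graph of $G'$; and there is a polynomial-time computable length-doubling bijection between shortest reconfiguration sequences from $P$ to $Q$ and shortest reconfiguration sequences from $\varphi(P)$ to $\varphi(Q)$ in the TAR-graph of $G'$ with parameter $k+1$.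
   Context: Shortest path reconfiguration graph of $G$: vertices are shortest $(s,t)$-paths (as vertex sequences), adjacent iff they differ in exactly one position. Construction of $G'$: let $G_1$ be obtained from $G$ by deleting all vertices and edges not lying on any shortest $(s,t)$-path; for $0\le i\le k$ let $D_i$ be the set of vertices of $G_1$ at distance $i$ from $s$ and $k-i$ from $t$. Then $V(G')=V(G_1)$ and $E(G')=\{uv: u\ne v,\ u,v\in D_i \text{ for some } i\}\cup\bigcup_{i=0}^{k-1}\{uv: u\in D_i, v\in D_{i+1}, uv\notin E(G_1)\}$. Independent sets are viewed as token sets. TS-graph: independent sets, adjacent if one is obtained from the other by sliding one token along an edge to an unoccupied neighbor. TJ-graph: adjacent if obtained by moving one token to any unoccupied vertex. TAR-graph with parameter $k'$: independent sets of size at least $k'-1$, adjacent if they differ by adding or removing one vertex. *)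

theory Defs
  imports "HOL-Library.Extended_Nat" "HOL-Computational_Algebra.Polynomial"
begin

section \<open>Finite simple graphs, walks and distances\<close>

record 'a graph =
  verts :: "'a set"
  edges :: "'a set set"

definition simple_graph :: "'a graph \<Rightarrow> bool" where
  "simple_graph G \<longleftrightarrow> finite (verts G) \<and>
     edges G \<subseteq> {{u, v} | u v. u \<in> verts G \<and> v \<in> verts G \<and> u \<noteq> v}"

definition adj :: "'a graph \<Rightarrow> 'a \<Rightarrow> 'a \<Rightarrow> bool" where
  "adj G u v \<longleftrightarrow> {u, v} \<in> edges G"

definition walks :: "'a graph \<Rightarrow> 'a \<Rightarrow> 'a \<Rightarrow> 'a list set" where
  "walks G u v = {w. w \<noteq> [] \<and> set w \<subseteq> verts G \<and> successively (adj G) w \<and> hd w = u \<and> last w = v}"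

definition paths :: "'a graph \<Rightarrow> 'a \<Rightarrow> 'a \<Rightarrow> 'a list set" where
  "paths G u v = {p \<in> walks G u v. distinct p}"

text \<open>The length of a vertex sequence is its number of steps, not its number of entries.\<close>

definition seq_len :: "'a list \<Rightarrow> nat" where
  "seq_len w = length w - 1"

text \<open>The distance is \<open>\<infinity>\<close> for unconnected vertices.\<close>

definition gdist :: "'a graph \<Rightarrow> 'a \<Rightarrow> 'a \<Rightarrow> enat" where
  "gdist G u v = (INF p \<in> paths G u v. enat (seq_len p))"

definition shortest :: "'a list set \<Rightarrow> 'a list set" where
  "shortest A = {p \<in> A. \<forall>q \<in> A. seq_len p \<le> seq_len q}"

definition shortest_paths :: "'a graph \<Rightarrow> 'a \<Rightarrow> 'a \<Rightarrow> 'a list set" where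
  "shortest_paths G s t = shortest (paths G s t)"

definition indep_set :: "'a graph \<Rightarrow> 'a set \<Rightarrow> bool" where
  "indep_set H A \<longleftrightarrow> A \<subseteq> verts H \<and> (\<forall>u \<in> A. \<forall>v \<in> A. \<not> adj H u v)"


section \<open>Reconfiguration graphs\<close>

definition spr_graph :: "'a graph \<Rightarrow> 'a \<Rightarrow> 'a \<Rightarrow> 'a list graph" where
  "spr_graph G s t =
     \<lparr>verts = shortest_paths G s t,
      edges = {{P, Q} | P Q. P \<in> shortest_paths G s t \<and> Q \<in> shortest_paths G s t \<and>
                 length P = length Q \<and> card {i. i < length P \<and> P ! i \<noteq> Q ! i} = 1}\<rparr>"

definition ts_graph :: "'a graph \<Rightarrow> 'a set graph" where
  "ts_graph H =
     \<lparr>verts = {A. indep_set H A},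
      edges = {{A, B} | A B. indep_set H A \<and> indep_set H B \<and>
                 (\<exists>u \<in> A. \<exists>v \<in> verts H - A. adj H u v \<and> B = insert v (A - {u}))}\<rparr>"

definition tj_graph :: "'a graph \<Rightarrow> 'a set graph" where
  "tj_graph H =
     \<lparr>verts = {A. indep_set H A},
      edges = {{A, B} | A B. indep_set H A \<and> indep_set H B \<and>
                 (\<exists>u \<in> A. \<exists>v \<in> verts H - A. B = insert v (A - {u}))}\<rparr>"

definition tar_graph :: "nat \<Rightarrow> 'a graph \<Rightarrow> 'a set graph" where
  "tar_graph k H =
     (let V = {A. indep_set H A \<and> card A \<ge> k - 1} in
      \<lparr>verts = V,
       edges = {{A, B} | A B. A \<in> V \<and> B \<in> V \<and> (\<exists>v \<in> verts H - A. B = insert v A)}\<rparr>)"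

definition reconf_seqs :: "'c graph \<Rightarrow> 'c \<Rightarrow> 'c \<Rightarrow> 'c list set" where
  "reconf_seqs R P Q = walks R P Q"

definition shortest_reconf_seqs :: "'c graph \<Rightarrow> 'c \<Rightarrow> 'c \<Rightarrow> 'c list set" where
  "shortest_reconf_seqs R P Q = shortest (reconf_seqs R P Q)"

definition scaling_bij :: "nat \<Rightarrow> ('b list \<Rightarrow> 'c list) \<Rightarrow> 'b list set \<Rightarrow> 'c list set \<Rightarrow> bool" where
  "scaling_bij c f A B \<longleftrightarrow> bij_betw f A B \<and> (\<forall>S \<in> A. seq_len (f S) = c * seq_len S)"


section \<open>The graph constructed from a graph and two of its vertices\<close>

definition path_edges :: "'a list \<Rightarrow> 'a set set" where
  "path_edges p = {{p ! i, p ! Suc i} | i. Suc i < length p}"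

definition geodesic_subgraph :: "'a graph \<Rightarrow> 'a \<Rightarrow> 'a \<Rightarrow> 'a graph" where
  "geodesic_subgraph G s t =
     \<lparr>verts = {v \<in> verts G. \<exists>p \<in> shortest_paths G s t. v \<in> set p},
      edges = {e \<in> edges G. \<exists>p \<in> shortest_paths G s t. e \<in> path_edges p}\<rparr>"

definition layer :: "'a graph \<Rightarrow> 'a \<Rightarrow> 'a \<Rightarrow> nat \<Rightarrow> nat \<Rightarrow> 'a set" where
  "layer G s t k i =
     (let G1 = geodesic_subgraph G s t in
      {v \<in> verts G1. gdist G1 s v = enat i \<and> gdist G1 v t = enat (k - i)})"

text \<open>To be used with \<open>k\<close> the distance of \<open>s\<close> and \<open>t\<close>.\<close>

definition layered_cograph :: "'a graph \<Rightarrow> 'a \<Rightarrow> 'a \<Rightarrow> nat \<Rightarrow> 'a graph" where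
  "layered_cograph G s t k =
     (let G1 = geodesic_subgraph G s t; D = layer G s t k in
      \<lparr>verts = verts G1,
       edges = {{u, v} | u v. u \<noteq> v \<and> (\<exists>i \<le> k. u \<in> D i \<and> v \<in> D i)} \<union>
               (\<Union>i<k. {{u, v} | u v. u \<in> D i \<and> v \<in> D (Suc i) \<and> {u, v} \<notin> edges G1})\<rparr>)"


section \<open>Turing machines and polynomial time\<close>

text \<open>
  Deterministic multi-tape Turing machines with two-way infinite tapes. The tape alphabet is
  \<open>{0..<g}\<close> with \<open>0\<close> the blank; a tape is its contents together with the head position. The
  states are the positions of the list of commands, the start state is \<open>0\<close>, and the only halting
  state is the length of the list. A command maps the list of scanned symbols to the next state
  and, for each tape, the symbol to write and the head movement. The input is on the first tape
  and the output on the last one.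
\<close>

type_synonym symbol = nat
type_synonym tape = "(int \<Rightarrow> symbol) \<times> int"
type_synonym command = "symbol list \<Rightarrow> nat \<times> (symbol \<times> int) list"
type_synonym machine = "command list"
type_synonym config = "nat \<times> tape list"

definition turing_machine :: "nat \<Rightarrow> nat \<Rightarrow> machine \<Rightarrow> bool" where
  "turing_machine n g M \<longleftrightarrow> n \<ge> 1 \<and>
     (\<forall>cmd \<in> set M. \<forall>xs. length xs = n \<and> set xs \<subseteq> {..<g} \<longrightarrow>
        fst (cmd xs) \<le> length M \<and> length (snd (cmd xs)) = n \<and>
        snd (cmd xs) \<in> lists ({..<g} \<times> {-1, 0, 1}))"

definition read_tape :: "tape \<Rightarrow> symbol" where
  "read_tape T = fst T (snd T)"

definition act :: "symbol \<times> int \<Rightarrow> tape \<Rightarrow> tape" where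
  "act a T = ((fst T)(snd T := fst a), snd T + snd a)"

definition step :: "machine \<Rightarrow> config \<Rightarrow> config" where
  "step M c =
     (if fst c < length M
      then (let (q, as) = (M ! fst c) (map read_tape (snd c)) in (q, map2 act as (snd c)))
      else c)"

definition contents :: "symbol list \<Rightarrow> int \<Rightarrow> symbol" where
  "contents w i = (if 0 \<le> i \<and> nat i < length w then w ! nat i else 0)"

definition start_config :: "nat \<Rightarrow> symbol list \<Rightarrow> config" where
  "start_config n w = (0, (contents w, 0) # replicate (n - 1) (contents [], 0))"

definition outputs_within :: "nat \<Rightarrow> machine \<Rightarrow> symbol list \<Rightarrow> symbol list \<Rightarrow> nat \<Rightarrow> bool" where
  "outputs_within n M w v T \<longleftrightarrow>
     (let c = (step M ^^ T) (start_config n w)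
      in fst c = length M \<and> fst (last (snd c)) = contents v)"


text \<open>
  Encoding of the data by words over the symbols \<open>1\<close>, ..., \<open>5\<close>: the symbols \<open>1\<close> and \<open>2\<close> are the
  binary digits zero and one (least significant digit first), and \<open>3\<close>, \<open>4\<close>, \<open>5\<close> terminate
  numbers, lists of numbers and lists of lists of numbers.
\<close>

fun enc_digits :: "nat \<Rightarrow> symbol list" where
  "enc_digits n = (if n = 0 then [] else (1 + n mod 2) # enc_digits (n div 2))"

declare enc_digits.simps [simp del]

definition enc_nat :: "nat \<Rightarrow> symbol list" where
  "enc_nat n = enc_digits n @ [3]"

definition enc_list :: "nat list \<Rightarrow> symbol list" where
  "enc_list xs = concat (map enc_nat xs) @ [4]"

definition enc_lists :: "nat list list \<Rightarrow> symbol list" where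
  "enc_lists xss = concat (map enc_list xss) @ [5]"

text \<open>
  A word represents an object with respect to a naming \<open>l\<close> of the vertices by numbers, which is
  injective on the graph at hand but otherwise arbitrary. Finite sets are represented by
  any of their enumerations without repetition, so the words for a given object are not unique.
\<close>

type_synonym 'a naming = "'a \<Rightarrow> nat"

definition rep_instance :: "'a naming \<Rightarrow> 'a graph \<times> 'a \<times> 'a \<Rightarrow> symbol list \<Rightarrow> bool" where
  "rep_instance l = (\<lambda>(G, s, t) w. inj_on l (verts G) \<and>
     (\<exists>vs es. distinct vs \<and> set vs = verts G \<and>
        distinct (map (\<lambda>(u, v). {u, v}) es) \<and> set (map (\<lambda>(u, v). {u, v}) es) = edges G \<and>
        w = enc_list (map l vs) @ enc_lists (map (\<lambda>(u, v). [l u, l v]) es) @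
            enc_nat (l s) @ enc_nat (l t)))"

definition rep_instance_path ::
    "'a naming \<Rightarrow> ('a graph \<times> 'a \<times> 'a) \<times> 'a list \<Rightarrow> symbol list \<Rightarrow> bool" where
  "rep_instance_path l = (\<lambda>(I, P) w. \<exists>w'. rep_instance l I w' \<and> w = w' @ enc_list (map l P))"

definition rep_instance_path_seq ::
    "'a naming \<Rightarrow> ('a graph \<times> 'a \<times> 'a) \<times> 'a list list \<Rightarrow> symbol list \<Rightarrow> bool" where
  "rep_instance_path_seq l =
     (\<lambda>(I, S) w. \<exists>w'. rep_instance l I w' \<and> w = w' @ enc_lists (map (map l) S))"

definition rep_set :: "'a naming \<Rightarrow> 'a set \<Rightarrow> symbol list \<Rightarrow> bool" where
  "rep_set l A w \<longleftrightarrow> (\<exists>xs. distinct xs \<and> set xs = A \<and> w = enc_list (map l xs))"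

definition rep_set_seq :: "'a naming \<Rightarrow> 'a set list \<Rightarrow> symbol list \<Rightarrow> bool" where
  "rep_set_seq l As w \<longleftrightarrow>
     (\<exists>xss. list_all2 (\<lambda>xs A. distinct xs \<and> set xs = A) xss As \<and>
        w = enc_lists (map (map l) xss))"

text \<open>
  The function \<open>f\<close> is computable in polynomial time on the domain \<open>D\<close>: a single machine, with a
  single polynomial bound, handles all elements of \<open>D\<close>, all namings and all representations.
\<close>

definition polytime_computable_on ::
    "'x set \<Rightarrow> ('a naming \<Rightarrow> 'x \<Rightarrow> symbol list \<Rightarrow> bool) \<Rightarrow>
     ('a naming \<Rightarrow> 'y \<Rightarrow> symbol list \<Rightarrow> bool) \<Rightarrow> ('x \<Rightarrow> 'y) \<Rightarrow> bool" where
  "polytime_computable_on D repX repY f \<longleftrightarrow>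
     (\<exists>n g M (p :: nat poly). g \<ge> 6 \<and> turing_machine n g M \<and>
        (\<forall>x \<in> D. \<forall>l w. repX l x w \<longrightarrow>
           (\<exists>v. repY l (f x) v \<and> outputs_within n M w v (poly p (length w)))))"

definition instances :: "('a graph \<times> 'a \<times> 'a) set" where
  "instances = {(G, s, t). simple_graph G \<and> s \<in> verts G \<and> t \<in> verts G \<and> gdist G s t \<noteq> \<infinity>}"

definition path_inputs :: "(('a graph \<times> 'a \<times> 'a) \<times> 'a list) set" where
  "path_inputs = {((G, s, t), P). (G, s, t) \<in> instances \<and> P \<in> shortest_paths G s t}"

definition path_seq_inputs :: "(('a graph \<times> 'a \<times> 'a) \<times> 'a list list) set" where
  "path_seq_inputs = {((G, s, t), S). (G, s, t) \<in> instances \<and>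
     (\<exists>P \<in> shortest_paths G s t. \<exists>Q \<in> shortest_paths G s t.
        S \<in> shortest_reconf_seqs (spr_graph G s t) P Q)}"

end

theory Submission
  imports Defs
begin

text \<open>
  Every vertex of a shortest path has a well-defined position, so a layer of the constructed graph
  contains exactly the vertices at one position. Layers are cliques, hence an independent set has
  at most one vertex per layer; if it has \<open>k + 1\<close> vertices, it has exactly one in each layer, and
  these form a path because consecutive ones are not joined in the constructed graph. Thus a path
  is mapped to its vertex set. A token that jumps must stay in its layer, so that token jumping
  and token sliding both amount to changing one vertex of the path. Under addition and removal a
  walk alternates between sizes \<open>k + 1\<close> and \<open>k\<close>; on a shortest one, the set between \<open>A\<close> and \<open>B\<close>
  is \<open>A \<inter> B\<close>, since otherwise two steps cancel and can be dropped.

  Both maps are computed in linear time. A machine skips the instance and copies the path, which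
  also enumerates its vertex set. For sequences, it compares consecutive paths vertex by vertex,
  using that the common vertices of two shortest paths occupy equal positions.
\<close>

section \<open>Walks, shortest paths and distances\<close>

text \<open>Distances are handled through walks, because gluing pieces of two paths need not
  preserve distinctness; a walk from \<open>s\<close> to \<open>t\<close> with only \<open>k\<close>
  steps is a path anyway. Most combinatorial steps are then a splice followed by a count. The claims
  on sequences rest on one principle: every sequence in the target graph is the image of a source
  walk or strictly longer than the scaled length of some source walk. The TS- and TJ-graphs contain
  independent sets of every size, so it must also be excluded that a sequence leaves the image of
  the paths. For the second machine the obstacle is that two vertex names may differ only after
  several equal digits, so nothing can be written while they are being compared. The output is
  therefore read from a separate head that waits at the start of the name until the comparison is
  over. As a set may be represented by any of its enumerations, the order of the vertices on a path
  can be kept.\<close>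

lemma walks_append:
  assumes "u \<noteq> []" "v \<noteq> []"
  shows "u @ v \<in> walks G a b \<longleftrightarrow>
    u \<in> walks G a (last u) \<and> v \<in> walks G (hd v) b \<and> adj G (last u) (hd v)"
  using assms by (auto simp: walks_def successively_append_iff)

lemma walks_Cons: "x # w \<in> walks G a b \<longleftrightarrow>
   x = a \<and> x \<in> verts G \<and> (if w = [] then x = b else adj G x (hd w) \<and> w \<in> walks G (hd w) b)"
  by (cases w) (auto simp: walks_def)

lemma walks_mono:
  assumes "verts H \<subseteq> verts G" "edges H \<subseteq> edges G"
  shows "walks H a b \<subseteq> walks G a b"
  using assms by (auto simp: walks_def adj_def elim!: successively_mono)

text \<open>The closed piece between two occurrences of the same vertex can be removed.\<close>

lemma walk_cut:
  assumes "w \<in> walks G a b" "\<not> distinct w"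
  shows "\<exists>w' \<in> walks G a b. length w' < length w"
proof -
  obtain xs ys zs y where w: "w = xs @ [y] @ ys @ [y] @ zs"
    using not_distinct_decomp[OF assms(2)] by blast
  have "xs @ [y] @ zs \<in> walks G a b"
    using assms(1) unfolding w
    by (cases "xs = []"; cases "zs = []") (auto simp: walks_def successively_append_iff successively_Cons)
  then show ?thesis unfolding w by force
qed

lemma path_below_walk:
  "w \<in> walks G a b \<Longrightarrow> \<exists>p \<in> paths G a b. length p \<le> length w"
proof (induction "length w" arbitrary: w rule: less_induct)
  case less
  show ?case
  proof (cases "distinct w")
    case True
    then show ?thesis using less.prems by (auto simp: paths_def)
  next
    case False
    then show ?thesis using walk_cut[OF less.prems] less.hyps by (meson le_trans less_imp_le)
  qed
qed

lemma length_walk: "w \<in> walks G a b \<Longrightarrow> length w = Suc (seq_len w)"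
  by (cases w) (auto simp: walks_def seq_len_def)

text \<open>Turns the infimum over paths into an attained minimum over walks, which have the same
  least length because repetitions can be cut out. Lower bounds on distances then follow by
  exhibiting walks.\<close>

lemma gdist_eq_enat:
  "gdist G a b = enat k \<longleftrightarrow>
     (\<exists>w \<in> walks G a b. length w = Suc k) \<and> (\<forall>w \<in> walks G a b. Suc k \<le> length w)"
  (is "?L \<longleftrightarrow> ?R")
proof
  assume L: ?L
  \<comment> \<open>The infimum of the empty set is \<infinity>, not \<open>enat k\<close>; a
    nonempty infimum in \<open>enat\<close> is a least element, hence attained.\<close>
  then have "paths G a b \<noteq> {}" by (auto simp: gdist_def top_enat_def)
  then have "gdist G a b \<in> (\<lambda>p. enat (seq_len p)) ` paths G a b"
    unfolding gdist_def Inf_enat_def using LeastI_ex[of "\<lambda>x. x \<in> (\<lambda>p. enat (seq_len p)) ` paths G a b"]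
    by auto
  then obtain p where p: "p \<in> paths G a b" "seq_len p = k" using L by auto
  have min: "k \<le> seq_len q" if "q \<in> paths G a b" for q
  proof -
    have "enat k \<le> enat (seq_len q)" unfolding L[symmetric] gdist_def using that by (rule INF_lower)
    then show ?thesis by simp
  qed
  have "Suc k \<le> length w" if w: "w \<in> walks G a b" for w
  proof -
    obtain q where "q \<in> paths G a b" "length q \<le> length w" using path_below_walk[OF w] by blast
    then show ?thesis using min[of q] length_walk[of q G a b]
      by (simp add: paths_def)
  qed
  moreover have "p \<in> walks G a b" using p(1) by (simp add: paths_def)
  ultimately show ?R using p(2) length_walk[of p G a b] by blast
next
  assume R: ?R
  then obtain w where w: "w \<in> walks G a b" "length w = Suc k" by blast
  then have "distinct w" using R walk_cut[OF w(1)] by fastforce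
  then have p: "w \<in> paths G a b" "seq_len w = k" using w by (auto simp: paths_def seq_len_def)
  show ?L
    unfolding gdist_def
  proof (rule antisym)
    show "(INF p\<in>paths G a b. enat (seq_len p)) \<le> enat k" using INF_lower[OF p(1)] p(2) by metis
    show "enat k \<le> (INF p\<in>paths G a b. enat (seq_len p))"
    proof (rule INF_greatest)
      fix q assume "q \<in> paths G a b"
      then have "q \<in> walks G a b" by (simp add: paths_def)
      then have "Suc k \<le> Suc (seq_len q)" using conjunct2[OF R, rule_format, of q] length_walk[of q G a b] by simp
      then show "enat k \<le> enat (seq_len q)" by simp
    qed
  qed
qed

text \<open>Cutting a repetition out of a walk with \<open>Suc k\<close> entries would beat the
  distance, so distinctness comes for free and never has to be checked after splicing.\<close>

lemma shortest_paths_eq: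
  assumes "gdist G s t = enat k"
  shows "shortest_paths G s t = {w \<in> walks G s t. length w = Suc k}"
proof -
  have min: "\<forall>w \<in> walks G s t. Suc k \<le> length w"
    and ex: "\<exists>w \<in> walks G s t. length w = Suc k"
    using assms by (auto simp: gdist_eq_enat)
  have path: "w \<in> paths G s t" if "w \<in> walks G s t" "length w = Suc k" for w
    using walk_cut[OF that(1)] that min by (fastforce simp: paths_def)
  show ?thesis
  proof (intro equalityI subsetI CollectI conjI)
    fix w assume w: "w \<in> shortest_paths G s t"
    then have *: "w \<in> walks G s t" by (auto simp: shortest_paths_def shortest_def paths_def)
    obtain w0 where "w0 \<in> paths G s t" "length w0 = Suc k" using ex path by blast
    then have "seq_len w \<le> k" using w by (auto simp: shortest_paths_def shortest_def seq_len_def)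
    with * min show "length w = Suc k" "w \<in> walks G s t" using length_walk by fastforce+
  next
    fix w assume "w \<in> {w \<in> walks G s t. length w = Suc k}"
    then show "w \<in> shortest_paths G s t"
      using path min by (fastforce simp: shortest_paths_def shortest_def paths_def seq_len_def)
  qed
qed

lemma take_walk: "w \<in> walks G a b \<Longrightarrow> i < length w \<Longrightarrow> take (Suc i) w \<in> walks G a (w ! i)"
  and drop_walk: "w \<in> walks G a b \<Longrightarrow> i < length w \<Longrightarrow> drop i w \<in> walks G (w ! i) b"
proof -
  assume w: "w \<in> walks G a b" "i < length w"
  have "successively (adj G) (take (Suc i) w)" "successively (adj G) (drop i w)"
    using w(1) successively_append_iff[of "adj G" "take (Suc i) w" "drop (Suc i) w"]
      successively_append_iff[of "adj G" "take i w" "drop i w"] by (auto simp: walks_def)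
  then show "take (Suc i) w \<in> walks G a (w ! i)" "drop i w \<in> walks G (w ! i) b"
    using w set_take_subset[of "Suc i" w] set_drop_subset[of i w]
    by (auto simp: walks_def hd_drop_conv_nth take_Suc_conv_app_nth hd_append hd_conv_nth)
qed

lemma join_walks:
  assumes "u \<in> walks G a c" "v \<in> walks G c b"
  shows "u @ tl v \<in> walks G a b" "length (u @ tl v) = length u + length v - 1"
proof -
  obtain v' where v: "v = c # v'" using assms(2) by (cases v) (auto simp: walks_def)
  show "u @ tl v \<in> walks G a b"
    using assms unfolding v
    by (cases "v' = []") (auto simp: walks_def successively_append_iff successively_Cons)
  show "length (u @ tl v) = length u + length v - 1" by (simp add: v)
qed

lemma successively_nth: "successively P xs \<longleftrightarrow> (\<forall>i. Suc i < length xs \<longrightarrow> P (xs ! i) (xs ! Suc i))"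
  by (auto simp: successively_conv_nth)

lemma adj_sym: "adj G u v \<longleftrightarrow> adj G v u"
  by (simp add: adj_def insert_commute)

section \<open>Reconfiguration sequences\<close>

text \<open>By \<open>ex\<close>, an element of \<open>B\<close> outside the image is strictly
  longer than the image of some element of \<open>A\<close>, so it is never shortest; on the image,
  scaling by \<open>c > 0\<close> preserves the order of lengths.\<close>

lemma scaling_bij_shortest:
  assumes c: "c > 0" and inj: "inj_on F A" and into: "F ` A \<subseteq> B"
    and len: "\<And>x. x \<in> A \<Longrightarrow> seq_len (F x) = c * seq_len x"
    and ex: "\<And>y. y \<in> B \<Longrightarrow> \<exists>x \<in> A. F x = y \<or> c * seq_len x < seq_len y"
  shows "scaling_bij c F (shortest A) (shortest B)"
proof -
  have "F x \<in> shortest B" if x: "x \<in> shortest A" for x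
  proof -
    have xA: "x \<in> A" and min: "\<And>x'. x' \<in> A \<Longrightarrow> seq_len x \<le> seq_len x'"
      using x by (auto simp: shortest_def)
    have "seq_len (F x) \<le> seq_len y" if y: "y \<in> B" for y
    proof -
      obtain x' where x': "x' \<in> A" "c * seq_len x' \<le> seq_len y"
        using ex[OF y] len by force
      then have "c * seq_len x \<le> c * seq_len x'" using min by simp
      then show ?thesis using x' len[OF xA] by linarith
    qed
    then show ?thesis using xA into by (auto simp: shortest_def)
  qed
  moreover have "y \<in> F ` shortest A" if y: "y \<in> shortest B" for y
  proof -
    have yB: "y \<in> B" and min: "\<And>y'. y' \<in> B \<Longrightarrow> seq_len y \<le> seq_len y'"
      using y by (auto simp: shortest_def)
    obtain x where x: "x \<in> A" "F x = y \<or> c * seq_len x < seq_len y" using ex[OF yB] by blast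
    have minF: "seq_len y \<le> c * seq_len x'" if "x' \<in> A" for x'
      using min[of "F x'"] len[OF that] into that by auto
    \<comment> \<open>The strict alternative would make \<open>F x\<close> shorter than the shortest
      element \<open>y\<close>.\<close>
    then have "F x = y" using x by fastforce
    moreover have "seq_len x \<le> seq_len x'" if "x' \<in> A" for x'
      using minF[OF that] len[OF x(1)] c \<open>F x = y\<close> by simp
    ultimately show ?thesis using x(1) by (auto simp: shortest_def)
  qed
  ultimately show ?thesis
    using inj len by (auto simp: scaling_bij_def bij_betw_def shortest_def inj_on_def)
qed

lemma walk_verts: "w \<in> walks R a b \<Longrightarrow> set w \<subseteq> verts R"
  and walk_ends: "w \<in> walks R a b \<Longrightarrow> w \<noteq> [] \<and> hd w = a \<and> last w = b"
  by (auto simp: walks_def)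

text \<open>The image of \<open>f\<close> is an induced copy of \<open>R\<close> and, by
  \<open>closed\<close>, a union of connected components of \<open>R'\<close>. A walk that starts in
  it can be pulled back vertex by vertex, so no walk of \<open>R'\<close> is missed.\<close>

lemma scaling_bij_embedding:
  assumes inj: "inj_on f (verts R)" and img: "f ` verts R \<subseteq> verts R'"
    and adj: "\<And>x y. x \<in> verts R \<Longrightarrow> y \<in> verts R \<Longrightarrow> adj R' (f x) (f y) \<longleftrightarrow> adj R x y"
    and closed: "\<And>x B. x \<in> verts R \<Longrightarrow> adj R' (f x) B \<Longrightarrow> B \<in> f ` verts R"
    and P: "P \<in> verts R" and Q: "Q \<in> verts R"
  shows "scaling_bij 1 (map f) (shortest_reconf_seqs R P Q) (shortest_reconf_seqs R' (f P) (f Q))"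
  unfolding shortest_reconf_seqs_def reconf_seqs_def
proof (rule scaling_bij_shortest)
  have walk_map: "map f w \<in> walks R' (f a) (f b)" if "w \<in> walks R a b" for w a b
    using that
  proof (induction w arbitrary: a)
    case (Cons x w)
    then show ?case using img adj
      by (cases w) (auto simp: walks_Cons image_subset_iff)
  qed (simp add: walks_def)
  show "map f ` walks R P Q \<subseteq> walks R' (f P) (f Q)" using walk_map by blast
  have "inj_on (map f) (lists (verts R))" using inj by (rule inj_on_mapI[OF inj_on_subset]) auto
  then show "inj_on (map f) (walks R P Q)"
    by (rule inj_on_subset) (use walk_verts in fastforce)
  have "\<exists>v \<in> walks R P Q. map f v = w" if "w \<in> walks R' (f P) (f Q)" "P \<in> verts R" for w P
    using that
  proof (induction w arbitrary: P)
    case (Cons A w)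
    show ?case
    proof (cases w)
      case Nil
      then have "P = Q" using Cons.prems inj Q by (auto simp: walks_Cons inj_on_def)
      then show ?thesis using Cons.prems Nil
        by (intro bexI[of _ "[P]"]) (auto simp: walks_Cons)
    next
      case (Cons B w')
      then have A: "A = f P" "adj R' (f P) B" "w \<in> walks R' B (f Q)"
        using Cons.prems by (auto simp: walks_Cons)
      obtain P' where P': "B = f P'" "P' \<in> verts R" using closed[OF Cons.prems(2) A(2)] by blast
      obtain v where v: "v \<in> walks R P' Q" "map f v = w" using Cons.IH A(3) P' by blast
      have "P # v \<in> walks R P Q"
        using v(1) walk_ends[OF v(1)] A(2) adj[OF Cons.prems(2) P'(2)] P' Cons.prems(2)
        by (simp add: walks_Cons)
      then show ?thesis using v A(1) by (intro bexI[of _ "P # v"]) auto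
    qed
  qed (simp add: walks_def)
  then show "\<exists>x \<in> walks R P Q. map f x = y \<or> 1 * seq_len x < seq_len y"
    if "y \<in> walks R' (f P) (f Q)" for y
    using that P by blast
qed (simp_all add: seq_len_def)

section \<open>Layers\<close>

locale geodesics =
  fixes G :: "'a graph" and s t :: 'a and k :: nat
  assumes simple: "simple_graph G" and dist: "gdist G s t = enat k"
begin

abbreviation "SP \<equiv> shortest_paths G s t"
abbreviation "G1 \<equiv> geodesic_subgraph G s t"
abbreviation "G' \<equiv> layered_cograph G s t k"

lemma SP_iff: "P \<in> SP \<longleftrightarrow> P \<in> walks G s t \<and> length P = Suc k"
  by (simp add: shortest_paths_eq[OF dist])

lemma walk_length: "w \<in> walks G s t \<Longrightarrow> Suc k \<le> length w"
  using dist by (simp add: gdist_eq_enat)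

lemma SP_distinct: "P \<in> SP \<Longrightarrow> distinct P"
  by (simp add: shortest_paths_def shortest_def paths_def)

lemma card_SP: "P \<in> SP \<Longrightarrow> card (set P) = k + 1"
  using SP_distinct SP_iff by (simp add: distinct_card)

text \<open>Following \<open>P\<close> up to position \<open>a\<close> and then \<open>Q\<close>
  from position \<open>b\<close> gives a walk from \<open>s\<close> to \<open>t\<close> with
  \<open>a + (k - b)\<close> steps. At least \<open>k\<close> are needed, so
  \<open>b \<le> a\<close>; exchanging the roles gives equality.\<close>

lemma position_unique:
  assumes P: "P \<in> SP" and Q: "Q \<in> SP" and ij: "i \<le> k" "j \<le> k" and eq: "P ! i = Q ! j"
  shows "i = j"
proof -
  have "b \<le> a" if "P \<in> SP" "Q \<in> SP" "a \<le> k" "b \<le> k" "P ! a = Q ! b" for P Q a b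
  proof -
    have "take (Suc a) P \<in> walks G s (P ! a)" "drop b Q \<in> walks G (P ! a) t"
      using that take_walk[of P G s t a] drop_walk[of Q G s t b] by (auto simp: SP_iff)
    from walk_length[OF join_walks(1)[OF this]] join_walks(2)[OF this]
    show ?thesis using that by (simp add: SP_iff)
  qed
  from this[OF P Q ij eq] this[OF Q P ij(2,1) eq[symmetric]] show ?thesis by simp
qed

lemma SP_nthE:
  assumes "P \<in> SP" "v \<in> set P"
  obtains i where "i \<le> k" "v = P ! i"
  using assms by (auto simp: SP_iff in_set_conv_nth less_Suc_eq_le)

lemma SP_nth_mem: "P \<in> SP \<Longrightarrow> i \<le> k \<Longrightarrow> P ! i \<in> set P"
  by (simp add: SP_iff)

lemma set_SP: "P \<in> SP \<Longrightarrow> set P = (!) P ` {..k}"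
  using SP_nthE SP_nth_mem by blast

text \<open>Layers described by positions on shortest paths, which are easier to splice than
  distances in \<open>G1\<close>; \<open>layer_eq\<close> shows that they are the layers of the
  construction.\<close>

definition L :: "nat \<Rightarrow> 'a set" where
  "L i = {P ! i | P. P \<in> SP}"

lemma nth_in_L: "P \<in> SP \<Longrightarrow> P ! i \<in> L i"
  by (auto simp: L_def)

lemma L_disjoint: "v \<in> L i \<Longrightarrow> v \<in> L j \<Longrightarrow> i \<le> k \<Longrightarrow> j \<le> k \<Longrightarrow> i = j"
  using position_unique by (auto simp: L_def)

lemma verts_G1: "verts G1 = (\<Union>i\<le>k. L i)"
proof -
  have "verts G1 = (\<Union>P\<in>SP. set P)"
    using SP_iff by (auto simp: geodesic_subgraph_def walks_def)
  also have "\<dots> = (\<Union>i\<le>k. L i)"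
    unfolding L_def using set_SP by blast
  finally show ?thesis .
qed

lemma verts_G': "verts G' = (\<Union>i\<le>k. L i)"
  by (simp add: layered_cograph_def Let_def verts_G1)

lemma finite_verts_G': "finite (verts G')"
proof -
  have "verts G' \<subseteq> verts G" by (auto simp: layered_cograph_def Let_def geodesic_subgraph_def)
  then show ?thesis using simple by (auto simp: simple_graph_def intro: finite_subset)
qed

lemma SP_walks_G1:
  assumes "P \<in> SP"
  shows "P \<in> walks G1 s t"
proof -
  have P: "P \<in> walks G s t" using assms by (simp add: SP_iff)
  have "{P ! i, P ! Suc i} \<in> edges G1" if "Suc i < length P" for i
  proof -
    have "{P ! i, P ! Suc i} \<in> edges G" using P that by (simp add: walks_def successively_nth adj_def)
    moreover have "{P ! i, P ! Suc i} \<in> path_edges P" using that by (auto simp: path_edges_def)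
    ultimately show ?thesis using assms by (auto simp: geodesic_subgraph_def)
  qed
  moreover have "set P \<subseteq> verts G1" using P assms by (auto simp: geodesic_subgraph_def walks_def)
  ultimately show ?thesis using P by (simp add: walks_def successively_nth adj_def)
qed

lemma walks_G1: "walks G1 a b \<subseteq> walks G a b"
  by (rule walks_mono) (auto simp: geodesic_subgraph_def)

text \<open>The two parts of a shortest path at position \<open>j\<close> survive in
  \<open>G1\<close> and bound both distances from above. A shorter walk to or from that vertex,
  completed by the other part, would join \<open>s\<close> to \<open>t\<close> in fewer than
  \<open>k\<close> steps.\<close>

lemma layer_eq:
  assumes i: "i \<le> k"
  shows "layer G s t k i = L i"
proof -
  have gd: "gdist G1 s (P ! j) = enat j" "gdist G1 (P ! j) t = enat (k - j)"
    if P: "P \<in> SP" and j: "j \<le> k" for P j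
  proof -
    have lenP: "length P = Suc k" and walk: "P \<in> walks G s t" using P by (auto simp: SP_iff)
    have 1: "take (Suc j) P \<in> walks G1 s (P ! j)" "drop j P \<in> walks G1 (P ! j) t"
      using SP_walks_G1[OF P] j lenP by (auto intro: take_walk drop_walk)
    have 2: "take (Suc j) P \<in> walks G s (P ! j)" "drop j P \<in> walks G (P ! j) t"
      using 1 walks_G1 by blast+
    have "Suc j \<le> length w" if "w \<in> walks G1 s (P ! j)" for w
    proof -
      have "w \<in> walks G s (P ! j)" using that walks_G1 by blast
      from walk_length[OF join_walks(1)[OF this 2(2)]] join_walks(2)[OF this 2(2)]
      show ?thesis using lenP j by simp
    qed
    moreover have "length (take (Suc j) P) = Suc j" using lenP j by simp
    ultimately show "gdist G1 s (P ! j) = enat j" using 1 unfolding gdist_eq_enat by blast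
    have "Suc (k - j) \<le> length w" if "w \<in> walks G1 (P ! j) t" for w
    proof -
      have "w \<in> walks G (P ! j) t" using that walks_G1 by blast
      from walk_length[OF join_walks(1)[OF 2(1) this]] join_walks(2)[OF 2(1) this]
      show ?thesis using lenP j by simp
    qed
    moreover have "length (drop j P) = Suc (k - j)" using lenP j by simp
    ultimately show "gdist G1 (P ! j) t = enat (k - j)" using 1 unfolding gdist_eq_enat by blast
  qed
  show ?thesis
  proof (intro equalityI subsetI)
    fix v assume "v \<in> layer G s t k i"
    then have v: "v \<in> verts G1" "gdist G1 s v = enat i" by (auto simp: layer_def Let_def)
    obtain j P where "j \<le> k" "P \<in> SP" "v = P ! j" using v(1) unfolding verts_G1 L_def by blast
    then show "v \<in> L i" using gd(1)[of P j] v(2) by (auto simp: L_def)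
  next
    fix v assume v: "v \<in> L i"
    then have "v \<in> verts G1" using i verts_G1 by blast
    then show "v \<in> layer G s t k i" using v gd i by (auto simp: layer_def Let_def L_def)
  qed
qed

text \<open>Passing to \<open>G1\<close> loses no edge of \<open>G\<close> between consecutive
  layers: a shortest path up to \<open>u\<close>, the edge, and a shortest path from
  \<open>v\<close> onwards again have \<open>k\<close> steps in total.\<close>

lemma edge_G1:
  assumes "u \<in> L i" "v \<in> L (Suc i)" "i < k"
  shows "{u, v} \<in> edges G1 \<longleftrightarrow> adj G u v"
proof
  show "{u, v} \<in> edges G1 \<Longrightarrow> adj G u v" by (auto simp: geodesic_subgraph_def adj_def)
next
  assume adj: "adj G u v"
  obtain P Q where PQ: "P \<in> SP" "u = P ! i" "Q \<in> SP" "v = Q ! Suc i" using assms by (auto simp: L_def)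
  have len: "length P = Suc k" "length Q = Suc k" using PQ SP_iff by auto
  have walks: "take (Suc i) P \<in> walks G s u" "drop (Suc i) Q \<in> walks G v t"
    using PQ assms(3) len by (auto simp: SP_iff intro: take_walk drop_walk)
  have ne: "take (Suc i) P \<noteq> []" "drop (Suc i) Q \<noteq> []" using len assms(3) by auto
  define R where "R = take (Suc i) P @ drop (Suc i) Q"
  have "last (take (Suc i) P) = u" "hd (drop (Suc i) Q) = v"
    using walks by (auto simp: walks_def)
  then have "R \<in> walks G s t"
    unfolding R_def using walks_append[OF ne] walks adj by simp
  moreover have "length R = Suc k" using len assms(3) by (simp add: R_def)
  ultimately have R: "R \<in> SP" by (simp add: SP_iff)
  have "R ! i = u" "R ! Suc i = v" using len assms(3) PQ by (auto simp: R_def nth_append)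
  then have "{u, v} \<in> path_edges R" using \<open>length R = Suc k\<close> assms(3) by (auto simp: path_edges_def)
  then show "{u, v} \<in> edges G1" using R adj by (auto simp: geodesic_subgraph_def adj_def)
qed

lemma adj_G':
  "adj G' u v \<longleftrightarrow> (u \<noteq> v \<and> (\<exists>i\<le>k. u \<in> L i \<and> v \<in> L i)) \<or>
     (\<exists>i<k. (u \<in> L i \<and> v \<in> L (Suc i) \<or> v \<in> L i \<and> u \<in> L (Suc i)) \<and> \<not> adj G u v)"
proof -
  have "(\<exists>a b. {u, v} = {a, b} \<and> a \<noteq> b \<and> (\<exists>i\<le>k. a \<in> layer G s t k i \<and> b \<in> layer G s t k i)) \<longleftrightarrow>
      u \<noteq> v \<and> (\<exists>i\<le>k. u \<in> L i \<and> v \<in> L i)"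
    unfolding doubleton_eq_iff using layer_eq by metis
  moreover have "adj G' u v \<longleftrightarrow>
     (\<exists>a b. {u, v} = {a, b} \<and> a \<noteq> b \<and> (\<exists>i\<le>k. a \<in> layer G s t k i \<and> b \<in> layer G s t k i)) \<or>
     (\<exists>i<k. \<exists>a b. {u, v} = {a, b} \<and> a \<in> layer G s t k i \<and> b \<in> layer G s t k (Suc i) \<and> {a, b} \<notin> edges G1)"
    unfolding adj_def layered_cograph_def Let_def graph.select_convs Un_iff UN_iff mem_Collect_eq Bex_def lessThan_iff ..
  ultimately have "adj G' u v \<longleftrightarrow> (u \<noteq> v \<and> (\<exists>i\<le>k. u \<in> L i \<and> v \<in> L i)) \<or>
     (\<exists>i<k. \<exists>a b. {u, v} = {a, b} \<and> a \<in> layer G s t k i \<and> b \<in> layer G s t k (Suc i) \<and> {a, b} \<notin> edges G1)"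
    by simp
  also have "(\<exists>i<k. \<exists>a b. {u, v} = {a, b} \<and> a \<in> layer G s t k i \<and> b \<in> layer G s t k (Suc i) \<and> {a, b} \<notin> edges G1)
    \<longleftrightarrow> (\<exists>i<k. (u \<in> L i \<and> v \<in> L (Suc i) \<or> v \<in> L i \<and> u \<in> L (Suc i)) \<and> \<not> adj G u v)"
  proof (intro ex_cong1 conj_cong refl)
    fix i assume i: "i < k"
    then have *: "layer G s t k i = L i" "layer G s t k (Suc i) = L (Suc i)" by (simp_all add: layer_eq)
    show "(\<exists>a b. {u, v} = {a, b} \<and> a \<in> layer G s t k i \<and> b \<in> layer G s t k (Suc i) \<and> {a, b} \<notin> edges G1) \<longleftrightarrow>
      (u \<in> L i \<and> v \<in> L (Suc i) \<or> v \<in> L i \<and> u \<in> L (Suc i)) \<and> \<not> adj G u v"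
      unfolding * doubleton_eq_iff using edge_G1[OF _ _ i] adj_sym by metis
  qed
  finally show ?thesis .
qed

section \<open>Independent sets of size k + 1 and shortest paths\<close>

lemma indep_SP:
  assumes P: "P \<in> SP"
  shows "indep_set G' (set P)"
  unfolding indep_set_def
proof (intro conjI ballI notI)
  show "set P \<subseteq> verts G'"
    unfolding verts_G' set_SP[OF P] using nth_in_L[OF P] by blast
next
  fix u v assume u: "u \<in> set P" and v: "v \<in> set P" and adj: "adj G' u v"
  obtain a b where ab: "a \<le> k" "u = P ! a" "b \<le> k" "v = P ! b"
    using SP_nthE[OF P u] SP_nthE[OF P v] by metis
  \<comment> \<open>A vertex in layer \<open>i\<close> has position \<open>i\<close> on
    \<open>P\<close>. An edge of \<open>G'\<close> inside \<open>P\<close> would thus join equal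
    vertices or consecutive vertices of \<open>P\<close> that are not adjacent in
    \<open>G\<close>.\<close>
  have lev: "P ! c \<in> L i \<Longrightarrow> i \<le> k \<Longrightarrow> c \<le> k \<Longrightarrow> c = i" for c i
    using L_disjoint nth_in_L[OF P] by blast
  have walk: "Suc c \<le> k \<Longrightarrow> adj G (P ! c) (P ! Suc c)" for c
    using P by (auto simp: SP_iff walks_def successively_nth)
  show False using adj unfolding adj_G' ab(2,4)
  proof (elim disjE conjE exE)
    fix i assume "P ! a \<noteq> P ! b" "i \<le> k" "P ! a \<in> L i" "P ! b \<in> L i"
    then show False using lev ab by metis
  next
    fix i assume "i < k" "P ! a \<in> L i" "P ! b \<in> L (Suc i)" "\<not> adj G (P ! a) (P ! b)"
    then show False using lev[of a i] lev[of b "Suc i"] ab walk[of i] by simp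
  next
    fix i assume "i < k" "P ! b \<in> L i" "P ! a \<in> L (Suc i)" "\<not> adj G (P ! a) (P ! b)"
    then show False using lev[of b i] lev[of a "Suc i"] ab walk[of i] adj_sym[of G "P ! a" "P ! b"] by simp
  qed
qed

definition lev :: "'a \<Rightarrow> nat" where
  "lev v = (THE i. i \<le> k \<and> v \<in> L i)"

lemma lev:
  assumes "v \<in> verts G'"
  shows "lev v \<le> k" "v \<in> L (lev v)"
proof -
  have "\<exists>!i. i \<le> k \<and> v \<in> L i" using assms L_disjoint unfolding verts_G' by blast
  from theI'[OF this] show "lev v \<le> k" "v \<in> L (lev v)" by (auto simp: lev_def)
qed

lemma lev_inj:
  assumes "indep_set G' A"
  shows "inj_on lev A" "lev ` A \<subseteq> {..k}" "finite A"
proof -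
  have A: "A \<subseteq> verts G'" using assms by (simp add: indep_set_def)
  show "finite A" using A finite_verts_G' finite_subset by blast
  show "lev ` A \<subseteq> {..k}" using A lev by blast
  show "inj_on lev A"
  proof (rule inj_onI)
    fix u v assume uv: "u \<in> A" "v \<in> A" "lev u = lev v"
    then have "\<not> adj G' u v" using assms by (simp add: indep_set_def)
    moreover have "u \<in> L (lev u)" "v \<in> L (lev u)" "lev u \<le> k" using uv A lev[of u] lev[of v] by auto
    ultimately show "u = v" unfolding adj_G' by blast
  qed
qed

lemma card_indep_le: "indep_set G' A \<Longrightarrow> card A \<le> k + 1"
  using card_inj_on_le[OF lev_inj(1,2)] by fastforce

text \<open>Makes the list built from an independent set start at \<open>s\<close> and end at
  \<open>t\<close>; the existence of a shortest path ensures that these layers are not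
  empty.\<close>

lemma ends: "L 0 = {s}" "L k = {t}"
proof -
  obtain w where "w \<in> walks G s t" "length w = Suc k" using dist by (auto simp: gdist_eq_enat)
  then have ne: "\<exists>P. P \<in> SP" by (auto simp: SP_iff)
  have "P ! 0 = s \<and> P ! k = t" if "P \<in> SP" for P
    using that by (auto simp: SP_iff walks_def hd_conv_nth last_conv_nth)
  then show "L 0 = {s}" "L k = {t}" using ne unfolding L_def by auto
qed

lemma indep_is_SP:
  assumes A: "indep_set G' A" and card: "card A = k + 1"
  shows "\<exists>P \<in> SP. set P = A"
proof -
  have AV: "A \<subseteq> verts G'" using A by (simp add: indep_set_def)
  \<comment> \<open>Pigeonhole: \<open>lev\<close> is injective on \<open>k + 1\<close> vertices and
    has only \<open>k + 1\<close> possible values.\<close>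
  have img: "lev ` A = {..k}"
    using lev_inj[OF A] card by (intro card_subset_eq) (auto simp: card_image)
  define P where "P = map (inv_into A lev) [0..<Suc k]"
  have len: "length P = Suc k" by (simp add: P_def)
  have nth: "P ! i \<in> A" "P ! i \<in> L i" if "i \<le> k" for i
  proof -
    have i: "i \<in> lev ` A" using that img by simp
    have Pi: "P ! i = inv_into A lev i" unfolding P_def using that by (subst nth_map) (auto simp del: upt_Suc)
    show "P ! i \<in> A" unfolding Pi using i by (rule inv_into_into)
    moreover have "lev (P ! i) = i" unfolding Pi using i by (rule f_inv_into_f)
    ultimately show "P ! i \<in> L i" using lev AV by fastforce
  qed
  have setP: "set P = A"
  proof -
    have "set P = inv_into A lev ` {..k}" by (auto simp: P_def simp del: upt_Suc)
    also have "\<dots> = A" unfolding img[symmetric] using lev_inj(1)[OF A] by (simp add: inv_into_image_cancel)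
    finally show ?thesis .
  qed
  have "adj G (P ! i) (P ! Suc i)" if "i < k" for i
  proof -
    have "\<not> adj G' (P ! i) (P ! Suc i)" using A nth that by (auto simp: indep_set_def)
    then show ?thesis using nth(2)[of i] nth(2)[of "Suc i"] that unfolding adj_G' by auto
  qed
  moreover have "P ! 0 = s" "P ! k = t" using nth(2)[of 0] nth(2)[of k] ends by auto
  moreover have "set P \<subseteq> verts G"
    using setP AV by (auto simp: layered_cograph_def Let_def geodesic_subgraph_def)
  moreover have "hd P = P ! 0" "last P = P ! k" "P \<noteq> []"
    using len hd_conv_nth[of P] last_conv_nth[of P] by fastforce+
  ultimately have "P \<in> SP" using len by (auto simp: SP_iff walks_def successively_nth)
  then show ?thesis using setP by blast
qed

text \<open>The order of the vertices can be recovered from the set, since a vertex has the same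
  position on all shortest paths.\<close>

lemma inj_SP: "inj_on set SP"
proof (rule inj_onI, rule nth_equalityI)
  fix P Q assume PQ: "P \<in> SP" "Q \<in> SP" "set P = set Q"
  then show "length P = length Q" by (simp add: SP_iff)
  fix i assume "i < length P"
  then have i: "i \<le> k" using PQ by (simp add: SP_iff)
  then have "P ! i \<in> set Q" using PQ SP_nth_mem by auto
  then obtain j where "j \<le> k" "P ! i = Q ! j" using SP_nthE[OF PQ(2)] by metis
  then show "P ! i = Q ! i" using position_unique[OF PQ(1,2) i] by metis
qed

lemma bij_SP: "bij_betw set SP {A. indep_set G' A \<and> card A = k + 1}"
  unfolding bij_betw_def using inj_SP indep_SP card_SP indep_is_SP by blast

end

section \<open>Turing machine runs\<close>

text \<open>The number of steps is an upper bound, so that consecutive phases are combined by adding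
  estimates.\<close>

definition reaches :: "machine \<Rightarrow> nat \<Rightarrow> config \<Rightarrow> config \<Rightarrow> bool" where
  "reaches M n c c' \<longleftrightarrow> (\<exists>m\<le>n. (step M ^^ m) c = c')"

lemma reaches_trans [trans]:
  assumes "reaches M m a b" "reaches M n b c"
  shows "reaches M (m + n) a c"
proof -
  obtain i j where "i \<le> m" "j \<le> n" "(step M ^^ i) a = b" "(step M ^^ j) b = c"
    using assms unfolding reaches_def by blast
  then have "(step M ^^ (j + i)) a = c" "j + i \<le> m + n"
    by (simp_all add: funpow_add)
  then show ?thesis unfolding reaches_def by blast
qed

lemma reaches_mono: "reaches M m a b \<Longrightarrow> m \<le> n \<Longrightarrow> reaches M n a b"
  unfolding reaches_def using le_trans by blast

lemma reaches_refl: "reaches M 0 c c"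
  by (simp add: reaches_def)

lemma reaches_step: "step M c = c' \<Longrightarrow> reaches M 1 c c'"
  unfolding reaches_def by (intro exI[of _ 1]) simp

text \<open>A halted configuration is a fixed point of \<open>step\<close>, so halting early still
  counts at the exact time \<open>n\<close>.\<close>

lemma outputs_withinI:
  assumes "reaches M n (start_config k w) (length M, Ts)" "fst (last Ts) = contents v"
  shows "outputs_within k M w v n"
proof -
  obtain m where m: "m \<le> n" "(step M ^^ m) (start_config k w) = (length M, Ts)"
    using assms(1) unfolding reaches_def by blast
  have halt: "(step M ^^ i) (length M, Ts) = (length M, Ts)" for i
    by (induction i) (simp_all add: step_def)
  have "(step M ^^ n) (start_config k w) = (step M ^^ (n - m)) ((step M ^^ m) (start_config k w))"
    using m(1) by (metis comp_apply funpow_add le_add_diff_inverse2)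
  then show ?thesis using assms(2) m(2) halt by (simp add: outputs_within_def)
qed

text \<open>A zipper: the head is on the first symbol of \<open>v\<close>, or on the blank just
  behind \<open>u\<close> if \<open>v\<close> is empty, so that writing and moving right extends the
  word.\<close>

definition tape_at :: "symbol list \<Rightarrow> symbol list \<Rightarrow> tape" where
  "tape_at u v = (contents (u @ v), int (length u))"

lemma contents_update:
  "(contents (u @ v))(int (length u) := a) = contents (u @ a # drop 1 v)"
  by (cases v; rule ext) (auto simp: contents_def nth_append nth_Cons' nat_eq_iff)

lemma read_tape_at [simp]:
  "read_tape (tape_at u (x # v)) = x" "read_tape (tape_at u []) = 0"
  by (simp_all add: read_tape_def tape_at_def contents_def)

lemma act_tape_at [simp]:
  "act (a, 1) (tape_at u (x # v)) = tape_at (u @ [a]) v"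
  "act (a, 1) (tape_at u []) = tape_at (u @ [a]) []"
  using contents_update[of u "x # v" a] contents_update[of u "[]" a]
  by (simp_all add: act_def tape_at_def)

lemma act_stay [simp]: "act (read_tape T, 0) T = T"
  by (simp add: act_def read_tape_def)

lemma act_stay_at [simp]: "act (x, 0) (tape_at u (x # v)) = tape_at u (x # v)"
  using act_stay[of "tape_at u (x # v)"] by simp

lemma act_stay_end [simp]: "act (0, 0) (tape_at u []) = tape_at u []"
  using act_stay[of "tape_at u []"] by simp

lemma act_write_end: "act (a, 0) (tape_at u []) = (contents (u @ [a]), int (length (u @ [a])) - 1)"
  using contents_update[of u "[]" a] by (simp add: act_def tape_at_def)

text \<open>\<open>C p v\<close> stands for all tapes when \<open>p\<close> has been read and
  \<open>v\<close> is still to come. Leaving it arbitrary covers loops that move several heads at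
  once.\<close>

lemma run_loop:
  assumes "\<And>p x v. x \<in> set u \<Longrightarrow> step M (q, C p (x # v)) = (q, C (p @ [x]) v)"
  shows "reaches M (length u) (q, C p (u @ v)) (q, C (p @ u) v)"
  using assms
proof (induction u arbitrary: p)
  case Nil
  then show ?case by (simp add: reaches_refl)
next
  case (Cons x u)
  have "reaches M 1 (q, C p (x # u @ v)) (q, C (p @ [x]) (u @ v))"
    by (rule reaches_step) (simp add: Cons.prems)
  also have "reaches M (length u) (q, C (p @ [x]) (u @ v)) (q, C ((p @ [x]) @ u) v)"
    using Cons.IH[of "p @ [x]"] Cons.prems by simp
  finally show ?case by simp
qed

lemma scan_loop:
  assumes "\<And>p x v. x \<noteq> c \<Longrightarrow> step M (q, C p (x # v)) = (q, C (p @ [x]) v)"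
    and exit: "\<And>p v. step M (q, C p (c # v)) = (q', C' (p @ [c]) v)"
    and "c \<notin> set u"
  shows "reaches M (length u + 1) (q, C p (u @ c # v)) (q', C' (p @ u @ [c]) v)"
proof -
  have "reaches M (length u) (q, C p (u @ c # v)) (q, C (p @ u) (c # v))"
    using assms(3) by (intro run_loop assms(1)) metis
  also have "reaches M 1 (q, C (p @ u) (c # v)) (q', C' (p @ u @ [c]) v)"
    using exit[of "p @ u" v] by (intro reaches_step) simp
  finally show ?thesis .
qed

section \<open>Words encoding numbers and lists\<close>

lemma set_enc_digits: "set (enc_digits n) \<subseteq> {1, 2}"
proof (induction n rule: enc_digits.induct)
  case (1 n)
  show ?case
  proof (cases "n = 0")
    case False
    have "1 + n mod 2 \<in> {1, 2}" by auto
    then show ?thesis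
      unfolding enc_digits.simps[of n] using 1[OF False] False by simp
  qed (simp add: enc_digits.simps)
qed

lemma enc_digits_inject: "enc_digits m = enc_digits n \<longleftrightarrow> m = n"
proof
  show "m = n" if "enc_digits m = enc_digits n"
    using that
  proof (induction m arbitrary: n rule: enc_digits.induct)
    case (1 m)
    show ?case
    proof (cases "m = 0 \<or> n = 0")
      case True
      then show ?thesis using "1.prems" enc_digits.simps[of m] enc_digits.simps[of n]
        by (auto split: if_splits)
    next
      case False
      then have "m mod 2 = n mod 2" "enc_digits (m div 2) = enc_digits (n div 2)"
        using "1.prems" enc_digits.simps[of m] enc_digits.simps[of n] by auto
      then show ?thesis using 1 False by (metis div_mult_mod_eq)
    qed
  qed
qed simp

lemma set_enc_nat: "set (enc_nat n) \<subseteq> {1, 2, 3}"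
  using set_enc_digits[of n] by (auto simp: enc_nat_def)

lemma enc_list_body: "set (concat (map enc_nat xs)) \<subseteq> {1, 2, 3}"
  unfolding set_concat set_map using set_enc_nat by blast

lemma enc_lists_body: "set (concat (map enc_list xss)) \<subseteq> {1, 2, 3, 4}"
proof -
  have "set (enc_list xs) \<subseteq> {1, 2, 3, 4}" for xs
    using enc_list_body[of xs] unfolding enc_list_def set_append by auto
  then show ?thesis unfolding set_concat set_map by blast
qed

lemma enc_list_simps:
  "enc_list [] = [4]" "enc_list (x # xs) = enc_nat x @ enc_list xs"
  by (simp_all add: enc_list_def)

lemma enc_lists_simps:
  "enc_lists [] = [5]" "enc_lists (xs # xss) = enc_list xs @ enc_lists xss"
  by (simp_all add: enc_lists_def)

lemma four_notin: "4 \<notin> set (concat (map enc_nat xs))"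
  using enc_list_body[of xs] by fastforce

lemma five_notin: "5 \<notin> set (concat (map enc_list xss))"
  using enc_lists_body[of xss] by fastforce

lemma three_notin: "3 \<notin> set (enc_digits n)"
  using set_enc_digits[of n] by fastforce

text \<open>The separators \<open>4\<close>, \<open>5\<close>, \<open>3\<close>, \<open>3\<close> end the vertices, the edges, \<open>s\<close> and \<open>t\<close>.\<close>

lemma skip_instance:
  assumes w: "rep_instance l I w"
    and cmds: "\<And>q. q < 4 \<Longrightarrow> q < length M"
      "\<And>q xs. q < 4 \<Longrightarrow> xs \<noteq> [] \<Longrightarrow>
         (M ! q) xs = (if hd xs = [4, 5, 3, 3] ! q then Suc q else q,
           (hd xs, 1) # map (\<lambda>x. (x, 0)) (tl xs))"
  shows "reaches M (length w) (0, tape_at [] (w @ v) # Ts) (4, tape_at w v # Ts)"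
proof -
  obtain G s t vs es where
    w: "w = enc_list (map l vs) @ enc_lists (map (\<lambda>(u, v). [l u, l v]) es) @
            enc_nat (l s) @ enc_nat (l t)"
    using w by (auto simp: rep_instance_def split: prod.splits)
  have map2_act: "map2 act (map (\<lambda>x. (read_tape x, 0)) Ts) Ts = Ts"
    by (induction Ts) auto
  have scan: "reaches M (length u + 1) (q, tape_at p (u @ c # v) # Ts)
      (Suc q, tape_at (p @ u @ [c]) v # Ts)"
    if "q < 4" "c = [4, 5, 3, 3] ! q" "c \<notin> set u" for q c u p v
    using that cmds map2_act
    by (intro scan_loop[where C = "\<lambda>p v. tape_at p v # Ts" and C' = "\<lambda>p v. tape_at p v # Ts"])
       (simp_all add: step_def o_def)
  define a b where "a = concat (map enc_nat (map l vs))"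
    and "b = concat (map enc_list (map (\<lambda>(u, v). [l u, l v]) es))"
  have notin: "4 \<notin> set a" "5 \<notin> set b"
    unfolding a_def b_def by (rule four_notin five_notin)+
  have w': "w = a @ 4 # b @ 5 # enc_digits (l s) @ 3 # enc_digits (l t) @ 3 # []"
    by (simp add: w a_def b_def enc_list_def enc_lists_def enc_nat_def)
  have "reaches M (length a + 1) (0, tape_at [] (w @ v) # Ts)
      (1, tape_at (a @ [4]) (b @ 5 # enc_digits (l s) @ 3 # enc_digits (l t) @ 3 # v) # Ts)"
    unfolding w' using scan[of 0 4 a "[]"] notin by simp
  \<comment> \<open>The edge list contains symbols \<open>3\<close> and \<open>4\<close> of its own;
    state \<open>1\<close> passes over them, as it waits for \<open>5\<close>.\<close>
  also have "reaches M (length b + 1) \<dots>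
      (2, tape_at (a @ 4 # b @ [5]) (enc_digits (l s) @ 3 # enc_digits (l t) @ 3 # v) # Ts)"
    using scan[of 1 5 b "a @ [4]"] notin by (simp add: numeral_2_eq_2)
  also have "reaches M (length (enc_digits (l s)) + 1) \<dots>
      (3, tape_at (a @ 4 # b @ 5 # enc_digits (l s) @ [3]) (enc_digits (l t) @ 3 # v) # Ts)"
    using scan[of 2 3 "enc_digits (l s)" "a @ 4 # b @ [5]"] three_notin by simp
  also have "reaches M (length (enc_digits (l t)) + 1) \<dots> (4, tape_at w v # Ts)"
    unfolding w' using scan[of 3 3 "enc_digits (l t)" "a @ 4 # b @ 5 # enc_digits (l s) @ [3]"]
      three_notin by simp
  finally show ?thesis by (rule reaches_mono) (simp add: w')
qed

text \<open>Phrased with \<open>hd\<close> and \<open>tl\<close> so that the same command serves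
  machines with different numbers of tapes.\<close>

definition skip_cmd :: "nat \<Rightarrow> command" where
  "skip_cmd q xs = (if hd xs = [4, 5, 3, 3] ! q then Suc q else q,
     (hd xs, 1) # map (\<lambda>x. (x, 0)) (tl xs))"

section \<open>The machine for vertex sets\<close>

definition path_machine :: machine where
  "path_machine = map skip_cmd [0..<4] @
     [\<lambda>xs. (if xs ! 0 = 4 then 5 else 4, [(xs ! 0, 1), (xs ! 0, 1)])]"

lemma turing_machine_path_machine: "turing_machine 2 6 path_machine"
  by (auto simp: turing_machine_def path_machine_def skip_cmd_def length_Suc_conv numeral_2_eq_2
      less_Suc_eq numeral_eq_Suc)

lemma path_machine_correct:
  assumes "rep_instance_path l (I, P) w"
  shows "outputs_within 2 path_machine w (enc_list (map l P)) (length w)"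
proof -
  obtain w' where w': "rep_instance l I w'" "w = w' @ enc_list (map l P)"
    using assms by (auto simp: rep_instance_path_def)
  define u where "u = concat (map enc_nat (map l P))"
  have start: "start_config 2 w = (0, tape_at [] (w' @ u @ [4]) # [tape_at [] []])"
    by (simp add: start_config_def tape_at_def w' u_def enc_list_def)
  have "reaches path_machine (length w') (start_config 2 w)
      (4, [tape_at w' (u @ 4 # []), tape_at [] []])"
    unfolding start
    by (rule skip_instance[OF w'(1)])
       (auto simp: path_machine_def nth_append skip_cmd_def)
  also have "reaches path_machine (length u + 1) \<dots>
      (5, [tape_at (w' @ u @ [4]) [], tape_at (u @ [4]) []])"
    using scan_loop[where C = "\<lambda>p v. [tape_at (w' @ p) v, tape_at p []]"
        and C' = "\<lambda>p v. [tape_at (w' @ p) v, tape_at p []]" and p = "[]" and v = "[]"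
        and c = 4 and q = 4 and q' = 5 and u = u and M = path_machine] four_notin[of "map l P"]
    by (simp add: step_def path_machine_def nth_append u_def)
  finally have "reaches path_machine (length w) (start_config 2 w)
      (length path_machine, [tape_at (w' @ u @ [4]) [], tape_at (u @ [4]) []])"
    by (simp add: path_machine_def u_def w' enc_list_def)
  then show ?thesis
    by (rule outputs_withinI) (simp add: tape_at_def u_def enc_list_def)
qed

lemma polytime_vertex_set:
  "polytime_computable_on path_inputs rep_instance_path rep_set (\<lambda>(I, P). set P)"
  unfolding polytime_computable_on_def
proof (intro exI conjI ballI allI impI)
  show "turing_machine 2 6 path_machine" by (rule turing_machine_path_machine)
next
  fix x :: "('a graph \<times> 'a \<times> 'a) \<times> 'a list" and l w
  assume x: "x \<in> path_inputs" and rep: "rep_instance_path l x w"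
  obtain I P where IP: "x = (I, P)" by (cases x)
  have "distinct P"
    using x by (auto simp: IP path_inputs_def shortest_paths_def shortest_def paths_def)
  then have "rep_set l (set P) (enc_list (map l P))"
    by (auto simp: rep_set_def)
  then show "rep_set l (case x of (I, P) \<Rightarrow> set P) (enc_list (map l (snd x)))"
    by (simp add: IP)
  show "outputs_within 2 path_machine w (enc_list (map l (snd x))) (poly [:0, 1:] (length w))"
    using path_machine_correct[of l I P w] rep by (simp add: IP)
qed simp

section \<open>The machine for sequences\<close>

text \<open>Used with \<inter> to produce the sequence of sets, and with \<open>common\<close> for
  its counterpart on lists, which is what the machine computes.\<close>

fun interleave :: "('b \<Rightarrow> 'b \<Rightarrow> 'b) \<Rightarrow> 'b list \<Rightarrow> 'b list" where
  "interleave g [] = []"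
| "interleave g [x] = [x]"
| "interleave g (x # y # xs) = x # g x y # interleave g (y # xs)"

text \<open>Compares entries only at equal positions; for shortest paths this already finds every
  common vertex, by \<open>set_common\<close>.\<close>

definition common :: "'b list \<Rightarrow> 'b list \<Rightarrow> 'b list" where
  "common xs ys = map fst (filter (\<lambda>(x, y). x = y) (zip xs ys))"

lemma common_simps [simp]:
  "common [] ys = []"
  "common (x # xs) (y # ys) = (if x = y then [x] else []) @ common xs ys"
  by (simp_all add: common_def)

definition advance :: "int \<Rightarrow> nat set \<Rightarrow> symbol list \<Rightarrow> (symbol \<times> int) list" where
  "advance d J xs = map (\<lambda>i. (xs ! i, if i \<in> J then d else 0)) [0, 1, 2, 3, 4, 5]"

definition emit :: "nat set \<Rightarrow> symbol \<Rightarrow> symbol list \<Rightarrow> (symbol \<times> int) list" where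
  "emit J a xs = (advance 1 J xs)[5 := (a, 1)]"

text \<open>
  Tapes \<open>1\<close> to \<open>4\<close> receive copies of the sequence of paths. Tapes \<open>1\<close> and \<open>2\<close> compare a path
  with its successor; tape \<open>3\<close>, on the path, copies the common vertices to the output, and tape
  \<open>4\<close>, on the successor, copies the latter.
\<close>

definition seq_machine :: machine where
  "seq_machine = map skip_cmd [0..<4] @
    [\<lambda>xs. if xs ! 0 = 5
        then (5, [(5, 0), (5, 0), (5, 0), (5, 0), (5, 0), (xs ! 5, 0)])
        else (4, [(xs ! 0, 1), (xs ! 0, 1), (xs ! 0, 1), (xs ! 0, 1), (xs ! 0, 1), (xs ! 5, 0)]),
     \<lambda>xs. if xs ! 1 = 0 then (6, advance 1 {1, 2, 3, 4} xs) else (5, advance (-1) {1, 2, 3, 4} xs),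
     \<lambda>xs. (if xs ! 4 = 4 then 7 else 6, emit {2, 4} (xs ! 4) xs),
     \<lambda>xs. if xs ! 2 = 5 then (13, emit {} 5 xs)
        else if xs ! 1 = 4 then (12, emit {1, 2, 3} 4 xs)
        else if xs ! 1 \<noteq> xs ! 2 then (9, advance 1 {} xs)
        else (if xs ! 1 = 3 then 8 else 7, advance 1 {1, 2} xs),
     \<lambda>xs. (if xs ! 3 = 3 then 7 else 8, emit {3} (xs ! 3) xs),
     \<lambda>xs. (if xs ! 1 = 3 then 10 else 9, advance 1 {1} xs),
     \<lambda>xs. (if xs ! 2 = 3 then 11 else 10, advance 1 {2} xs),
     \<lambda>xs. (if xs ! 3 = 3 then 7 else 11, advance 1 {3} xs),
     \<lambda>xs. (if xs ! 4 = 4 then 7 else 12, emit {4} (xs ! 4) xs)]"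

text \<open>Each symbol written is a scanned one or one of the constants \<open>4\<close> and
  \<open>5\<close>, so it stays below \<open>6\<close>.\<close>

lemma turing_machine_seq_machine: "turing_machine 6 6 seq_machine"
proof -
  have "fst (cmd xs) \<le> 13 \<and> length (snd (cmd xs)) = 6 \<and>
      snd (cmd xs) \<in> lists ({..<6} \<times> {-1, 0, 1})"
    if cmd: "cmd \<in> set seq_machine" and xs: "length xs = 6" "set xs \<subseteq> {..<6}" for cmd xs
  proof -
    define ok :: "nat \<times> (nat \<times> int) list \<Rightarrow> bool" where
      "ok r \<longleftrightarrow> fst r \<le> 13 \<and> length (snd r) = 6 \<and> set (snd r) \<subseteq> {..<6} \<times> {-1, 0, 1}" for r
    have nth: "xs ! i < 6" if "i < 6" for i
    proof -
      have "xs ! i \<in> set xs" using that xs(1) by simp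
      then show ?thesis using xs(2) by blast
    qed
    have ok_advance: "ok (q, advance d J xs)" if "q \<le> 13" "d \<in> {-1, 0, 1}" for q d J
      using that nth by (auto simp: ok_def advance_def)
    have ok_emit: "ok (q, emit J a xs)" if "q \<le> 13" "a < 6" for q J a
    proof -
      have "set (emit J a xs) \<subseteq> insert (a, 1) (set (advance 1 J xs))"
        unfolding emit_def by (rule set_update_subset_insert)
      then show ?thesis using ok_advance[of 0 1 J] that by (auto simp: ok_def emit_def)
    qed
    have "ok (cmd xs)"
    proof (cases "cmd \<in> skip_cmd ` {0..<4}")
      case True
      then show ?thesis using xs by (cases xs) (auto simp: ok_def skip_cmd_def)
    next
      case False
      then show ?thesis using cmd unfolding seq_machine_def
        by (elim UnE insertE set_append[THEN equalityD1, THEN subsetD, THEN UnE])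
           (auto simp: ok_advance ok_emit nth split: if_splits, auto simp: ok_def nth)
    qed
    then show ?thesis by (simp add: ok_def lists_eq_set)
  qed
  moreover have "length seq_machine = 13" by (simp add: seq_machine_def)
  ultimately show ?thesis by (simp add: turing_machine_def)
qed

section \<open>Runs of the sequence machine, phase by phase\<close>

lemma seq_machine_nth:
  "length seq_machine = 13"
  "q < 4 \<Longrightarrow> seq_machine ! q = skip_cmd q"
  "seq_machine ! 4 = (\<lambda>xs. if xs ! 0 = 5
        then (5, [(5, 0), (5, 0), (5, 0), (5, 0), (5, 0), (xs ! 5, 0)])
        else (4, [(xs ! 0, 1), (xs ! 0, 1), (xs ! 0, 1), (xs ! 0, 1), (xs ! 0, 1), (xs ! 5, 0)]))"
  "seq_machine ! 5 = (\<lambda>xs. if xs ! 1 = 0 then (6, advance 1 {1, 2, 3, 4} xs) else (5, advance (-1) {1, 2, 3, 4} xs))"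
  "seq_machine ! 6 = (\<lambda>xs. (if xs ! 4 = 4 then 7 else 6, emit {2, 4} (xs ! 4) xs))"
  "seq_machine ! 7 = (\<lambda>xs. if xs ! 2 = 5 then (13, emit {} 5 xs)
        else if xs ! 1 = 4 then (12, emit {1, 2, 3} 4 xs)
        else if xs ! 1 \<noteq> xs ! 2 then (9, advance 1 {} xs)
        else (if xs ! 1 = 3 then 8 else 7, advance 1 {1, 2} xs))"
  "seq_machine ! 8 = (\<lambda>xs. (if xs ! 3 = 3 then 7 else 8, emit {3} (xs ! 3) xs))"
  "seq_machine ! 9 = (\<lambda>xs. (if xs ! 1 = 3 then 10 else 9, advance 1 {1} xs))"
  "seq_machine ! 10 = (\<lambda>xs. (if xs ! 2 = 3 then 11 else 10, advance 1 {2} xs))"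
  "seq_machine ! 11 = (\<lambda>xs. (if xs ! 3 = 3 then 7 else 11, advance 1 {3} xs))"
  "seq_machine ! 12 = (\<lambda>xs. (if xs ! 4 = 4 then 7 else 12, emit {4} (xs ! 4) xs))"
  by (simp_all add: seq_machine_def nth_append)

lemmas seq_step = step_def seq_machine_nth advance_def emit_def

lemma replicate_4: "replicate 4 x = [x, x, x, x]"
  by (simp add: numeral_eq_Suc)

lemma copy_paths:
  fixes S :: "symbol list"
  assumes "5 \<notin> set S"
  shows "reaches seq_machine (length S + 1)
     (4, [tape_at u (S @ [5]), tape_at [] [], tape_at [] [], tape_at [] [], tape_at [] [], tape_at [] []])
     (5, [tape_at (u @ S) [5]] @ replicate 4 (contents (S @ [5]), int (length S)) @ [tape_at [] []])"
proof -
  have "reaches seq_machine (length S) (4, tape_at (u @ []) (S @ [5]) #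
      [tape_at [] [], tape_at [] [], tape_at [] [], tape_at [] [], tape_at [] []])
     (4, tape_at (u @ [] @ S) [5] # [tape_at S [], tape_at S [], tape_at S [], tape_at S [], tape_at [] []])"
    using run_loop[where C = "\<lambda>p v. [tape_at (u @ p) v, tape_at p [], tape_at p [], tape_at p [], tape_at p [], tape_at [] []]"
       and u = S and v = "[5]" and q = 4 and M = seq_machine and p = "[]"] assms
    by (force simp: seq_step)
  \<comment> \<open>The final \<open>5\<close> is written without moving: state \<open>5\<close>
    takes a blank for the left end, so the rewinding has to begin on a nonblank cell.\<close>
  also have "reaches seq_machine 1 \<dots>
     (5, [tape_at (u @ S) [5]] @ replicate 4 (contents (S @ [5]), int (length S)) @ [tape_at [] []])"
    by (rule reaches_step) (simp add: seq_step act_write_end[of 5] replicate_4)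
  finally show ?thesis by simp
qed

text \<open>The heads of all four copies move together until they scan the blank in cell
  \<open>-1\<close>, and then step right once. The case \<open>j = 0\<close> is the heads being on
  that blank.\<close>

lemma rewind_paths:
  assumes "0 \<notin> set S" "j \<le> length S"
  shows "reaches seq_machine (j + 1)
     (5, [tape_at u (a # v)] @ replicate 4 (contents S, int j - 1) @ [tape_at [] []])
     (6, [tape_at u (a # v)] @ replicate 4 (tape_at [] S) @ [tape_at [] []])"
  using assms(2)
proof (induction j)
  case 0
  have [simp]: "read_tape (contents S, -1) = 0" "act (0, 1) (contents S, -1) = tape_at [] S"
    by (auto simp: contents_def read_tape_def act_def tape_at_def)
  show ?case unfolding add_0
    by (rule reaches_step) (simp add: seq_step replicate_4)
next
  case (Suc j)
  have "S ! j \<noteq> 0" using assms(1) Suc.prems by (metis Suc_le_lessD nth_mem)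
  moreover have "read_tape (contents S, int j) = S ! j"
    "act (S ! j, -1) (contents S, int j) = (contents S, int j - 1)"
    using Suc.prems by (auto simp: contents_def read_tape_def act_def)
  ultimately have "reaches seq_machine 1
     (5, [tape_at u (a # v)] @ replicate 4 (contents S, int (Suc j) - 1) @ [tape_at [] []])
     (5, [tape_at u (a # v)] @ replicate 4 (contents S, int j - 1) @ [tape_at [] []])"
    by (intro reaches_step) (simp add: seq_step replicate_4)
  also have "reaches seq_machine (j + 1) \<dots>
     (6, [tape_at u (a # v)] @ replicate 4 (tape_at [] S) @ [tape_at [] []])"
    using Suc by simp
  finally show ?case by (simp add: add.commute)
qed

text \<open>Besides emitting the first path, this puts tapes \<open>2\<close> and \<open>4\<close>
  one path ahead of tapes \<open>1\<close> and \<open>3\<close>. Resting heads are given a nonempty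
  remainder, so that \<open>act_stay_at\<close> applies to them.\<close>

lemma copy_first_path:
  "reaches seq_machine (length (enc_list xs))
     (6, [tape_at u (a # t), tape_at p1 (b # v), tape_at p2 (enc_list xs @ v2),
          tape_at p3 (c # v3), tape_at p4 (enc_list xs @ v4), tape_at out []])
     (7, [tape_at u (a # t), tape_at p1 (b # v), tape_at (p2 @ enc_list xs) v2,
          tape_at p3 (c # v3), tape_at (p4 @ enc_list xs) v4, tape_at (out @ enc_list xs) []])"
proof -
  define w where "w = concat (map enc_nat xs)"
  have w: "4 \<notin> set w" unfolding w_def by (rule four_notin)
  let ?C = "\<lambda>p r. [tape_at u (a # t), tape_at p1 (b # v), tape_at (p2 @ p) (r @ v2),
          tape_at p3 (c # v3), tape_at (p4 @ p) (r @ v4), tape_at (out @ p) []]"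
  have "reaches seq_machine (length w + 1) (6, ?C [] (w @ 4 # [])) (7, ?C ([] @ w @ [4]) [])"
    by (rule scan_loop[where C = ?C and C' = ?C and p = "[]" and v = "[]" and u = "w" and c = 4])
       (simp_all add: seq_step w)
  then show ?thesis by (simp add: enc_list_def w_def)
qed

lemma copy_next_path:
  "reaches seq_machine (length (enc_list xs))
     (12, [tape_at u (a # t), tape_at p1 (b # v), tape_at p2 (b2 # v2),
          tape_at p3 (c # v3), tape_at p4 (enc_list xs @ v4), tape_at out []])
     (7, [tape_at u (a # t), tape_at p1 (b # v), tape_at p2 (b2 # v2),
          tape_at p3 (c # v3), tape_at (p4 @ enc_list xs) v4, tape_at (out @ enc_list xs) []])"
proof -
  define w where "w = concat (map enc_nat xs)"
  have w: "4 \<notin> set w" unfolding w_def by (rule four_notin)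
  let ?C = "\<lambda>p r. [tape_at u (a # t), tape_at p1 (b # v), tape_at p2 (b2 # v2),
          tape_at p3 (c # v3), tape_at (p4 @ p) (r @ v4), tape_at (out @ p) []]"
  have "reaches seq_machine (length w + 1) (12, ?C [] (w @ 4 # [])) (7, ?C ([] @ w @ [4]) [])"
    by (rule scan_loop[where C = ?C and C' = ?C and p = "[]" and v = "[]" and u = "w" and c = 4])
       (simp_all add: seq_step w)
  then show ?thesis by (simp add: enc_list_def w_def)
qed

lemma compare_digits:
  assumes "set w \<subseteq> {1, 2}"
  shows "reaches seq_machine (length w)
     (7, [tape_at u (a # t), tape_at p1 (w @ v1), tape_at p2 (w @ v2),
          tape_at p3 (c # v3), tape_at p4 (d # v4), tape_at out []])
     (7, [tape_at u (a # t), tape_at (p1 @ w) v1, tape_at (p2 @ w) v2,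
          tape_at p3 (c # v3), tape_at p4 (d # v4), tape_at out []])"
proof -
  let ?C = "\<lambda>p r. [tape_at u (a # t), tape_at (p1 @ p) (r @ v1), tape_at (p2 @ p) (r @ v2),
          tape_at p3 (c # v3), tape_at p4 (d # v4), tape_at out []]"
  have "x \<noteq> 3 \<and> x \<noteq> 4 \<and> x \<noteq> 5" if "x \<in> set w" for x using that assms by auto
  then have "reaches seq_machine (length w) (7, ?C [] (w @ [])) (7, ?C ([] @ w) [])"
    by (intro run_loop[where C = ?C and p = "[]" and v = "[]" and u = w]) (simp add: seq_step)
  then show ?thesis by simp
qed

text \<open>State \<open>8\<close> is entered once two numbers have turned out to be equal; tape
  \<open>3\<close> is still at the start of the number and supplies the output.\<close>

lemma copy_number:
  "reaches seq_machine (length (enc_nat x))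
     (8, [tape_at u (a # t), tape_at p1 (b # v), tape_at p2 (b2 # v2),
          tape_at p3 (enc_nat x @ v3), tape_at p4 (d # v4), tape_at out []])
     (7, [tape_at u (a # t), tape_at p1 (b # v), tape_at p2 (b2 # v2),
          tape_at (p3 @ enc_nat x) v3, tape_at p4 (d # v4), tape_at (out @ enc_nat x) []])"
proof -
  let ?C = "\<lambda>p r. [tape_at u (a # t), tape_at p1 (b # v), tape_at p2 (b2 # v2),
          tape_at (p3 @ p) (r @ v3), tape_at p4 (d # v4), tape_at (out @ p) []]"
  have "reaches seq_machine (length (enc_digits x) + 1) (8, ?C [] (enc_digits x @ 3 # []))
    (7, ?C ([] @ enc_digits x @ [3]) [])"
    by (rule scan_loop[where C = ?C and C' = ?C and p = "[]" and v = "[]" and u = "enc_digits x" and c = 3])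
       (simp_all add: seq_step three_notin)
  then show ?thesis by (simp add: enc_nat_def)
qed

text \<open>After a mismatch, states \<open>9\<close>, \<open>10\<close> and \<open>11\<close> move
  tapes \<open>1\<close>, \<open>2\<close> and \<open>3\<close> behind the current number without
  output. The first two may be in the middle of it.\<close>

lemma skip_numbers:
  assumes "3 \<notin> set x" "3 \<notin> set y" "3 \<notin> set z"
  shows "reaches seq_machine (length x + length y + length z + 3)
     (9, [tape_at u (a # t), tape_at p1 (x @ 3 # b # v), tape_at p2 (y @ 3 # v2),
          tape_at p3 (z @ 3 # v3), tape_at p4 (d # v4), tape_at out []])
     (7, [tape_at u (a # t), tape_at (p1 @ x @ [3]) (b # v), tape_at (p2 @ y @ [3]) v2,
          tape_at (p3 @ z @ [3]) v3, tape_at p4 (d # v4), tape_at out []])"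
proof -
  obtain b2 w2 where y: "y @ 3 # v2 = b2 # w2" by (cases y) auto
  obtain c w3 where z: "z @ 3 # v3 = c # w3" by (cases z) auto
  let ?C = "\<lambda>p r. [tape_at u (a # t), tape_at (p1 @ p) (r @ b # v), tape_at p2 (b2 # w2),
          tape_at p3 (c # w3), tape_at p4 (d # v4), tape_at out []]"
  have "reaches seq_machine (length x + 1) (9, ?C [] (x @ 3 # [])) (10, ?C ([] @ x @ [3]) [])"
    by (rule scan_loop[where C = ?C and C' = ?C and p = "[]" and v = "[]" and u = "x" and c = 3])
       (simp_all add: seq_step assms)
  then have "reaches seq_machine (length x + 1)
     (9, [tape_at u (a # t), tape_at p1 (x @ 3 # b # v), tape_at p2 (y @ 3 # v2),
          tape_at p3 (z @ 3 # v3), tape_at p4 (d # v4), tape_at out []])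
     (10, [tape_at u (a # t), tape_at (p1 @ x @ [3]) (b # v), tape_at p2 (y @ 3 # v2),
          tape_at p3 (z @ 3 # v3), tape_at p4 (d # v4), tape_at out []])"
    by (simp add: y z)
  also have "reaches seq_machine (length y + 1) \<dots>
     (11, [tape_at u (a # t), tape_at (p1 @ x @ [3]) (b # v), tape_at (p2 @ y @ [3]) v2,
          tape_at p3 (z @ 3 # v3), tape_at p4 (d # v4), tape_at out []])"
  proof -
    let ?C = "\<lambda>p r. [tape_at u (a # t), tape_at (p1 @ x @ [3]) (b # v), tape_at (p2 @ p) (r @ v2),
          tape_at p3 (c # w3), tape_at p4 (d # v4), tape_at out []]"
    have "reaches seq_machine (length y + 1) (10, ?C [] (y @ 3 # [])) (11, ?C ([] @ y @ [3]) [])"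
      by (rule scan_loop[where C = ?C and C' = ?C and p = "[]" and v = "[]" and u = "y" and c = 3])
         (simp_all add: seq_step assms)
    then show ?thesis by (simp add: z)
  qed
  also have "reaches seq_machine (length z + 1) \<dots>
     (7, [tape_at u (a # t), tape_at (p1 @ x @ [3]) (b # v), tape_at (p2 @ y @ [3]) v2,
          tape_at (p3 @ z @ [3]) v3, tape_at p4 (d # v4), tape_at out []])"
  \<comment> \<open>Tape \<open>2\<close> rests while tape \<open>3\<close> moves; it scans a blank
    if \<open>v2\<close> is empty, and the two situations need different rules for a resting
    head.\<close>
  proof (cases v2)
    case Nil
    let ?C = "\<lambda>p r. [tape_at u (a # t), tape_at (p1 @ x @ [3]) (b # v), tape_at (p2 @ y @ [3]) [],
          tape_at (p3 @ p) (r @ v3), tape_at p4 (d # v4), tape_at out []]"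
    have "reaches seq_machine (length z + 1) (11, ?C [] (z @ 3 # [])) (7, ?C ([] @ z @ [3]) [])"
      by (rule scan_loop[where C = ?C and C' = ?C and p = "[]" and v = "[]" and u = "z" and c = 3])
         (simp_all add: seq_step assms)
    then show ?thesis by (simp add: Nil)
  next
    case (Cons e w)
    let ?C = "\<lambda>p r. [tape_at u (a # t), tape_at (p1 @ x @ [3]) (b # v), tape_at (p2 @ y @ [3]) (e # w),
          tape_at (p3 @ p) (r @ v3), tape_at p4 (d # v4), tape_at out []]"
    have "reaches seq_machine (length z + 1) (11, ?C [] (z @ 3 # [])) (7, ?C ([] @ z @ [3]) [])"
      by (rule scan_loop[where C = ?C and C' = ?C and p = "[]" and v = "[]" and u = "z" and c = 3])
         (simp_all add: seq_step assms)
    then show ?thesis by (simp add: Cons)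
  qed
  finally show ?thesis by (rule reaches_mono) simp
qed

text \<open>The factor \<open>3\<close> is generous: equal numbers are read once and copied once,
  and for different ones each of the three heads passes its number once.\<close>

lemma compare_number:
  "reaches seq_machine (3 * (length (enc_nat x) + length (enc_nat y)))
     (7, [tape_at u (a # t), tape_at p1 (enc_nat x @ b # v1), tape_at p2 (enc_nat y @ b2 # v2),
          tape_at p3 (enc_nat x @ v3), tape_at p4 (d # v4), tape_at out []])
     (7, [tape_at u (a # t), tape_at (p1 @ enc_nat x) (b # v1), tape_at (p2 @ enc_nat y) (b2 # v2),
          tape_at (p3 @ enc_nat x) v3, tape_at p4 (d # v4),
          tape_at (out @ (if x = y then enc_nat x else [])) []])"
proof -
  obtain c w3 where c: "enc_nat x @ v3 = c # w3"
    by (cases "enc_digits x") (auto simp: enc_nat_def)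
  show ?thesis
  proof (cases "x = y")
    case True
    have "reaches seq_machine (length (enc_digits x))
      (7, [tape_at u (a # t), tape_at p1 (enc_nat x @ b # v1), tape_at p2 (enc_nat x @ b2 # v2),
          tape_at p3 (enc_nat x @ v3), tape_at p4 (d # v4), tape_at out []])
      (7, [tape_at u (a # t), tape_at (p1 @ enc_digits x) (3 # b # v1),
          tape_at (p2 @ enc_digits x) (3 # b2 # v2),
          tape_at p3 (enc_nat x @ v3), tape_at p4 (d # v4), tape_at out []])"
      using compare_digits[OF set_enc_digits, of x u a t p1 "3 # b # v1" p2 "3 # b2 # v2" p3 c w3]
      unfolding c by (simp add: enc_nat_def)
    also have "reaches seq_machine 1 \<dots>
      (8, [tape_at u (a # t), tape_at (p1 @ enc_nat x) (b # v1), tape_at (p2 @ enc_nat x) (b2 # v2),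
          tape_at p3 (enc_nat x @ v3), tape_at p4 (d # v4), tape_at out []])"
      unfolding c by (rule reaches_step) (simp add: seq_step enc_nat_def)
    also have "reaches seq_machine (length (enc_nat x)) \<dots>
      (7, [tape_at u (a # t), tape_at (p1 @ enc_nat x) (b # v1), tape_at (p2 @ enc_nat x) (b2 # v2),
          tape_at (p3 @ enc_nat x) v3, tape_at p4 (d # v4), tape_at (out @ enc_nat x) []])"
      by (rule copy_number)
    finally show ?thesis
      using True by (auto elim!: reaches_mono simp: enc_nat_def)
  next
    case False
    obtain pre r1 r2 where pre: "enc_digits x = pre @ r1" "enc_digits y = pre @ r2"
        "r1 = [] \<or> r2 = [] \<or> hd r1 \<noteq> hd r2"
      using longest_common_prefix[of "enc_digits x" "enc_digits y"] by blast
    have sets: "set pre \<subseteq> {1, 2}" "set r1 \<subseteq> {1, 2}" "set r2 \<subseteq> {1, 2}"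
      using set_enc_digits[of x] set_enc_digits[of y] by (auto simp: pre)
    have "r1 \<noteq> r2" using False pre by (metis enc_digits_inject)
    \<comment> \<open>If the digits of one number are a proper prefix of those of the other, the
      mismatch is between a separator \<open>3\<close> and a digit.\<close>
    then have hds: "hd (r1 @ [3]) \<noteq> hd (r2 @ [3])"
      using pre(3) sets(2,3) by (cases r1; cases r2) auto
    have notin: "3 \<notin> set r1" "3 \<notin> set r2" using sets by auto
    obtain h1 w1 where 1: "r1 @ [3] = h1 # w1" by (cases r1) auto
    obtain h2 w2 where 2: "r2 @ [3] = h2 # w2" by (cases r2) auto
    have "set (r1 @ [3]) \<subseteq> {1, 2, 3}" "set (r2 @ [3]) \<subseteq> {1, 2, 3}" using sets by auto
    \<comment> \<open>In state \<open>7\<close> a \<open>5\<close> on tape \<open>2\<close> or a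
      \<open>4\<close> on tape \<open>1\<close> is tested before the mismatch, so both must be
      excluded.\<close>
    then have hh: "h1 \<noteq> h2" "h1 \<noteq> 4" "h2 \<noteq> 5" using hds unfolding 1 2 by auto
    have app1: "r1 @ 3 # v = h1 # w1 @ v" for v using 1 by (metis append_Cons append_assoc append_Nil)
    have app2: "r2 @ 3 # v = h2 # w2 @ v" for v using 2 by (metis append_Cons append_assoc append_Nil)
    have "reaches seq_machine (length pre)
      (7, [tape_at u (a # t), tape_at p1 (enc_nat x @ b # v1), tape_at p2 (enc_nat y @ b2 # v2),
          tape_at p3 (enc_nat x @ v3), tape_at p4 (d # v4), tape_at out []])
      (7, [tape_at u (a # t), tape_at (p1 @ pre) (r1 @ 3 # b # v1),
          tape_at (p2 @ pre) (r2 @ 3 # b2 # v2),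
          tape_at p3 (enc_nat x @ v3), tape_at p4 (d # v4), tape_at out []])"
      using compare_digits[OF sets(1), of u a t p1 "r1 @ 3 # b # v1" p2 "r2 @ 3 # b2 # v2" p3 c w3]
      unfolding c by (simp add: enc_nat_def pre)
    also have "reaches seq_machine 1 \<dots>
      (9, [tape_at u (a # t), tape_at (p1 @ pre) (r1 @ 3 # b # v1),
          tape_at (p2 @ pre) (r2 @ 3 # b2 # v2),
          tape_at p3 (enc_nat x @ v3), tape_at p4 (d # v4), tape_at out []])"
      unfolding c app1 app2 using hh by (intro reaches_step) (simp add: seq_step)
    also have "reaches seq_machine (length r1 + length r2 + length (enc_digits x) + 3) \<dots>
      (7, [tape_at u (a # t), tape_at (p1 @ enc_nat x) (b # v1), tape_at (p2 @ enc_nat y) (b2 # v2),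
          tape_at (p3 @ enc_nat x) v3, tape_at p4 (d # v4), tape_at out []])"
      using skip_numbers[OF notin three_notin, of x u a t "p1 @ pre" b v1 "p2 @ pre" "b2 # v2" p3 v3]
      by (simp add: enc_nat_def pre)
    finally show ?thesis
      using False by (auto elim!: reaches_mono simp: enc_nat_def pre)
  qed
qed

lemma enc_list_Cons: "\<exists>h w. enc_list xs = h # w"
  by (cases "enc_list xs") (auto simp: enc_list_def)

lemma enc_lists_Cons: "\<exists>h w. enc_lists xss = h # w"
  by (cases "enc_lists xss") (auto simp: enc_lists_def)

text \<open>Equal lengths make both paths reach their terminating \<open>4\<close> together, so it
  is enough to look for it on tape \<open>1\<close>.\<close>

lemma compare_paths:
  assumes "length xs = length ys"
  shows "reaches seq_machine (3 * (length (enc_list xs) + length (enc_list ys)))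
     (7, [tape_at u (a # t), tape_at p1 (enc_list xs @ b # v1), tape_at p2 (enc_list ys @ b2 # v2),
          tape_at p3 (enc_list xs @ v3), tape_at p4 (d # v4), tape_at out []])
     (12, [tape_at u (a # t), tape_at (p1 @ enc_list xs) (b # v1),
          tape_at (p2 @ enc_list ys) (b2 # v2),
          tape_at (p3 @ enc_list xs) v3, tape_at p4 (d # v4),
          tape_at (out @ enc_list (common xs ys)) []])"
  using assms
proof (induction xs ys arbitrary: p1 p2 p3 out rule: list_induct2)
  case Nil
  have "reaches seq_machine 1
     (7, [tape_at u (a # t), tape_at p1 (enc_list [] @ b # v1), tape_at p2 (enc_list [] @ b2 # v2),
          tape_at p3 (enc_list [] @ v3), tape_at p4 (d # v4), tape_at out []])
     (12, [tape_at u (a # t), tape_at (p1 @ enc_list []) (b # v1),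
          tape_at (p2 @ enc_list []) (b2 # v2),
          tape_at (p3 @ enc_list []) v3, tape_at p4 (d # v4),
          tape_at (out @ enc_list (common [] [])) []])"
    by (rule reaches_step) (simp add: seq_step enc_list_simps)
  then show ?case by (rule reaches_mono) (simp add: enc_list_simps)
next
  case (Cons x xs y ys)
  obtain h1 w1 where 1: "enc_list xs @ b # v1 = h1 # w1" using enc_list_Cons[of xs] by auto
  obtain h2 w2 where 2: "enc_list ys @ b2 # v2 = h2 # w2" using enc_list_Cons[of ys] by auto
  have "reaches seq_machine (3 * (length (enc_nat x) + length (enc_nat y)))
     (7, [tape_at u (a # t), tape_at p1 (enc_list (x # xs) @ b # v1),
          tape_at p2 (enc_list (y # ys) @ b2 # v2),
          tape_at p3 (enc_list (x # xs) @ v3), tape_at p4 (d # v4), tape_at out []])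
     (7, [tape_at u (a # t), tape_at (p1 @ enc_nat x) (enc_list xs @ b # v1),
          tape_at (p2 @ enc_nat y) (enc_list ys @ b2 # v2),
          tape_at (p3 @ enc_nat x) (enc_list xs @ v3), tape_at p4 (d # v4),
          tape_at (out @ (if x = y then enc_nat x else [])) []])"
    using compare_number[of x y u a t p1 h1 w1 p2 h2 w2 p3 "enc_list xs @ v3"]
    by (simp add: enc_list_simps 1 2)
  also note Cons.IH
  finally show ?case
    by (auto elim!: reaches_mono simp: enc_list_simps)
qed

text \<open>Invariant: tapes \<open>1\<close> and \<open>3\<close> are at the current path, already
  emitted, and tapes \<open>2\<close> and \<open>4\<close> at its successor. A later path is charged
  \<open>3\<close> times its length as successor, once for being copied and at most \<open>3\<close>
  times as predecessor, hence \<open>7\<close>.\<close>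

lemma process_paths:
  assumes "\<forall>ys \<in> set yss. length ys = length xs"
  shows "\<exists>Ts. last Ts = tape_at (out @ enc_lists (interleave common (xs # yss))) [] \<and>
    reaches seq_machine (3 * length (enc_list xs) + 7 * length (enc_lists yss))
     (7, [tape_at u (a # t), tape_at p1 (enc_lists (xs # yss)), tape_at p2 (enc_lists yss),
          tape_at p3 (enc_lists (xs # yss)), tape_at p4 (enc_lists yss),
          tape_at (out @ enc_list xs) []])
     (13, Ts)"
  using assms
proof (induction yss arbitrary: xs p1 p2 p3 p4 out)
  case Nil
  obtain h1 w1 where 1: "enc_list xs @ [5] = h1 # w1" using enc_list_Cons[of xs] by auto
  \<comment> \<open>A \<open>5\<close> on tape \<open>2\<close> means that there is no successor; it
    only remains to close the output.\<close>
  have "reaches seq_machine 1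
     (7, [tape_at u (a # t), tape_at p1 (enc_lists [xs]), tape_at p2 (enc_lists []),
          tape_at p3 (enc_lists [xs]), tape_at p4 (enc_lists []),
          tape_at (out @ enc_list xs) []])
     (13, [tape_at u (a # t), tape_at p1 (enc_lists [xs]), tape_at p2 (enc_lists []),
          tape_at p3 (enc_lists [xs]), tape_at p4 (enc_lists []),
          tape_at (out @ enc_lists [xs]) []])"
    unfolding enc_lists_simps by (subst (1 2 3 4) 1, rule reaches_step) (simp add: seq_step)
  then show ?case
    by (intro exI conjI, rule_tac[2] reaches_mono) (auto simp: enc_lists_simps)
next
  case (Cons ys yss)
  obtain h1 w1 where 1: "enc_lists (ys # yss) = h1 # w1" using enc_lists_Cons by blast
  obtain h2 w2 where 2: "enc_lists yss = h2 # w2" using enc_lists_Cons by blast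
  obtain h3 w3 where 3: "enc_list ys @ enc_lists yss = h3 # w3"
    using enc_list_Cons[of ys] by auto
  have "reaches seq_machine (3 * (length (enc_list xs) + length (enc_list ys)))
     (7, [tape_at u (a # t), tape_at p1 (enc_lists (xs # ys # yss)), tape_at p2 (enc_lists (ys # yss)),
          tape_at p3 (enc_lists (xs # ys # yss)), tape_at p4 (enc_lists (ys # yss)),
          tape_at (out @ enc_list xs) []])
     (12, [tape_at u (a # t), tape_at (p1 @ enc_list xs) (enc_lists (ys # yss)),
          tape_at (p2 @ enc_list ys) (enc_lists yss),
          tape_at (p3 @ enc_list xs) (enc_lists (ys # yss)), tape_at p4 (enc_lists (ys # yss)),
          tape_at ((out @ enc_list xs) @ enc_list (common xs ys)) []])"
    using compare_paths[of xs ys u a t p1 h3 w3 p2 h2 w2 p3 "h3 # w3" p4 h3 w3 "out @ enc_list xs"]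
      Cons.prems
    by (simp add: enc_lists_simps 2[symmetric] 3[symmetric])
  also have "reaches seq_machine (length (enc_list ys)) \<dots>
     (7, [tape_at u (a # t), tape_at (p1 @ enc_list xs) (enc_lists (ys # yss)),
          tape_at (p2 @ enc_list ys) (enc_lists yss),
          tape_at (p3 @ enc_list xs) (enc_lists (ys # yss)),
          tape_at (p4 @ enc_list ys) (enc_lists yss),
          tape_at (((out @ enc_list xs) @ enc_list (common xs ys)) @ enc_list ys) []])"
    using copy_next_path[of ys u a t "p1 @ enc_list xs" h3 w3 "p2 @ enc_list ys" h2 w2
       "p3 @ enc_list xs" h3 w3 p4 "enc_lists yss" "(out @ enc_list xs) @ enc_list (common xs ys)"]
    by (simp add: enc_lists_simps 2[symmetric] 3[symmetric])
  finally have first: "reaches seq_machine (3 * (length (enc_list xs) + length (enc_list ys)) + length (enc_list ys))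
     (7, [tape_at u (a # t), tape_at p1 (enc_lists (xs # ys # yss)), tape_at p2 (enc_lists (ys # yss)),
          tape_at p3 (enc_lists (xs # ys # yss)), tape_at p4 (enc_lists (ys # yss)),
          tape_at (out @ enc_list xs) []])
     (7, [tape_at u (a # t), tape_at (p1 @ enc_list xs) (enc_lists (ys # yss)),
          tape_at (p2 @ enc_list ys) (enc_lists yss),
          tape_at (p3 @ enc_list xs) (enc_lists (ys # yss)),
          tape_at (p4 @ enc_list ys) (enc_lists yss),
          tape_at (((out @ enc_list xs) @ enc_list (common xs ys)) @ enc_list ys) []])" .
  obtain Ts where Ts: "last Ts = tape_at (((out @ enc_list xs) @ enc_list (common xs ys)) @
        enc_lists (interleave common (ys # yss))) []"
    and rest: "reaches seq_machine (3 * length (enc_list ys) + 7 * length (enc_lists yss))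
     (7, [tape_at u (a # t), tape_at (p1 @ enc_list xs) (enc_lists (ys # yss)),
          tape_at (p2 @ enc_list ys) (enc_lists yss),
          tape_at (p3 @ enc_list xs) (enc_lists (ys # yss)),
          tape_at (p4 @ enc_list ys) (enc_lists yss),
          tape_at (((out @ enc_list xs) @ enc_list (common xs ys)) @ enc_list ys) []])
     (13, Ts)"
    using Cons.IH[of ys] Cons.prems by fastforce
  show ?case
    using reaches_trans[OF first rest] Ts
    by (intro exI[of _ Ts] conjI) (auto elim!: reaches_mono simp: enc_lists_simps)
qed

lemma seq_machine_correct:
  assumes w: "rep_instance l I w" and "\<forall>ys \<in> set yss. length ys = length xs"
  shows "outputs_within 6 seq_machine (w @ enc_lists (xs # yss))
    (enc_lists (interleave common (xs # yss))) (1 + 9 * length (w @ enc_lists (xs # yss)))"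
proof -
  define E where "E = enc_lists (xs # yss)"
  define S where "S = concat (map enc_list (xs # yss))"
  have E: "E = S @ [5]" "E = enc_list xs @ enc_lists yss"
    by (simp_all add: E_def S_def enc_lists_def)
  have S: "5 \<notin> set S" unfolding S_def by (rule five_notin)
  have "0 \<notin> set S" using enc_lists_body[of "xs # yss"] unfolding S_def by fastforce
  then have E0: "0 \<notin> set E" by (simp add: E)
  obtain h1 w1 where h1: "E = h1 # w1" using enc_lists_Cons E_def by blast
  let ?T = "[tape_at [] [], tape_at [] [], tape_at [] [], tape_at [] [], tape_at [] []]"
  have start: "start_config 6 (w @ E) = (0, tape_at [] (w @ E) # ?T)"
    by (simp add: start_config_def tape_at_def numeral_eq_Suc)
  have "reaches seq_machine (length w) (start_config 6 (w @ E)) (4, tape_at w E # ?T)"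
    unfolding start
    by (rule skip_instance[OF w]) (auto simp: seq_machine_nth skip_cmd_def)
  also have "reaches seq_machine (length S + 1) \<dots>
     (5, [tape_at (w @ S) [5]] @ replicate 4 (contents E, int (length S)) @ [tape_at [] []])"
    using copy_paths[OF S] by (simp add: E)
  also have "reaches seq_machine (length E + 1) \<dots>
     (6, [tape_at (w @ S) [5]] @ replicate 4 (tape_at [] E) @ [tape_at [] []])"
    using rewind_paths[OF E0, of "length E" "w @ S" 5 "[]"] by (simp add: E(1))
  also have "reaches seq_machine (length (enc_list xs)) \<dots>
     (7, [tape_at (w @ S) [5], tape_at [] E, tape_at (enc_list xs) (enc_lists yss),
          tape_at [] E, tape_at (enc_list xs) (enc_lists yss), tape_at (enc_list xs) []])"
    using copy_first_path[of xs "w @ S" 5 "[]" "[]" h1 w1 "[]" "enc_lists yss" "[]" h1 w1 "[]" "enc_lists yss" "[]"]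
    by (simp add: h1[symmetric] E(2)[symmetric] replicate_4)
  finally have first: "reaches seq_machine (length w + (length S + 1) + (length E + 1) + length (enc_list xs))
    (start_config 6 (w @ E))
     (7, [tape_at (w @ S) [5], tape_at [] E, tape_at (enc_list xs) (enc_lists yss),
          tape_at [] E, tape_at (enc_list xs) (enc_lists yss), tape_at (enc_list xs) []])" .
  obtain Ts where Ts: "last Ts = tape_at (enc_lists (interleave common (xs # yss))) []"
    and rest: "reaches seq_machine (3 * length (enc_list xs) + 7 * length (enc_lists yss))
     (7, [tape_at (w @ S) [5], tape_at [] E, tape_at (enc_list xs) (enc_lists yss),
          tape_at [] E, tape_at (enc_list xs) (enc_lists yss), tape_at (enc_list xs) []])
     (13, Ts)"
    using process_paths[OF assms(2), of "[]" "w @ S" 5 "[]" "[]" "enc_list xs" "[]" "enc_list xs"]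
    by (auto simp: E_def)
  \<comment> \<open>Copying and rewinding cost \<open>2 * length E + 1\<close> steps, and the paths
    at most \<open>7 * length E\<close>, including the first copy; this gives the constants
    \<open>9\<close> and \<open>1\<close>.\<close>
  have "length E = length S + 1" "length E = length (enc_list xs) + length (enc_lists yss)"
    using arg_cong[OF E(1), of length] arg_cong[OF E(2), of length] by simp_all
  then have "reaches seq_machine (1 + 9 * length (w @ E)) (start_config 6 (w @ E)) (13, Ts)"
    by (intro reaches_mono[OF reaches_trans[OF first rest]]) simp
  then show ?thesis
    unfolding E_def[symmetric] using Ts
    by (intro outputs_withinI[where Ts = Ts]) (simp_all add: seq_machine_nth tape_at_def)
qed

section \<open>Interleaved sequences of names, paths and sets\<close>

lemma interleave_map:
  assumes "\<And>x y. x \<in> set xs \<Longrightarrow> y \<in> set xs \<Longrightarrow> g (h x) (h y) = h (f x y)"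
  shows "interleave g (map h xs) = map h (interleave f xs)"
  using assms by (induction f xs rule: interleave.induct) auto

lemma list_all2_interleave:
  assumes "\<And>x. x \<in> set xs \<Longrightarrow> R x (h x)"
    and "\<And>x y. x \<in> set xs \<Longrightarrow> y \<in> set xs \<Longrightarrow> R (f x y) (g (h x) (h y))"
  shows "list_all2 R (interleave f xs) (interleave g (map h xs))"
  using assms by (induction f xs rule: interleave.induct) auto

text \<open>The machine compares names; injectivity of the naming makes this the same as comparing
  vertices.\<close>

lemma common_map:
  assumes "length xs = length ys" "inj_on l (set xs \<union> set ys)"
  shows "common (map l xs) (map l ys) = map l (common xs ys)"
  using assms
proof (induction xs ys rule: list_induct2)
  case (Cons x xs y ys)
  have "inj_on l (set xs \<union> set ys)" using Cons.prems by (rule inj_on_subset) auto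
  moreover have "l x = l y \<longleftrightarrow> x = y" using inj_on_eq_iff[OF Cons.prems, of x y] by simp
  ultimately show ?case using Cons.IH by simp
qed simp

lemma interleave_Cons: "\<exists>ys. interleave g (x # xs) = x # ys"
  by (cases xs) auto

text \<open>The original entries remain at the even positions.\<close>

lemma interleave_inject: "interleave g xs = interleave g ys \<longleftrightarrow> xs = ys"
proof
  show "interleave g xs = interleave g ys \<Longrightarrow> xs = ys"
  proof (induction g xs arbitrary: ys rule: interleave.induct)
    case (1 g)
    then show ?case by (cases "(g, ys)" rule: interleave.cases) auto
  next
    case (2 g x)
    then show ?case by (cases "(g, ys)" rule: interleave.cases) auto
  next
    case (3 g x y xs)
    then show ?case by (cases "(g, ys)" rule: interleave.cases) auto
  qed
qed simp

lemma seq_len_interleave: "seq_len (interleave g xs) = 2 * seq_len xs"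
proof (induction g xs rule: interleave.induct)
  case (3 g x y xs)
  obtain ys where "interleave g (y # xs) = y # ys" using interleave_Cons[of g y xs] by auto
  then show ?case using 3 by (simp add: seq_len_def)
qed (simp_all add: seq_len_def)

context geodesics begin

lemma set_common:
  assumes P: "P \<in> SP" and Q: "Q \<in> SP"
  shows "set (common P Q) = set P \<inter> set Q"
proof -
  have len: "length P = Suc k" "length Q = Suc k" using P Q SP_iff by auto
  have "v \<in> set (common P Q) \<longleftrightarrow> v \<in> set P \<inter> set Q" for v
  proof
    assume "v \<in> set (common P Q)"
    then have "(v, v) \<in> set (zip P Q)" by (auto simp: common_def)
    then show "v \<in> set P \<inter> set Q" by (auto dest: set_zip_leftD set_zip_rightD)
  next
    assume v: "v \<in> set P \<inter> set Q"
    then obtain i j where ij: "i \<le> k" "v = P ! i" "j \<le> k" "v = Q ! j"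
      using SP_nthE[OF P] SP_nthE[OF Q] by (metis IntE)
    then have "i = j" using position_unique[OF P Q] by metis
    then have "(v, v) \<in> set (zip P Q)" using ij len by (auto simp: in_set_zip)
    then show "v \<in> set (common P Q)" unfolding common_def by force
  qed
  then show ?thesis by blast
qed

lemma distinct_common: "P \<in> SP \<Longrightarrow> distinct (common P Q)"
proof -
  assume "P \<in> SP"
  then have "distinct (map fst (zip P Q))"
    using SP_distinct by (simp add: map_fst_zip_take)
  then show ?thesis unfolding common_def by (rule distinct_map_filter)
qed

end

lemma polytime_interleaved_sets:
  "polytime_computable_on path_seq_inputs rep_instance_path_seq rep_set_seq
     (\<lambda>(I, S). interleave (\<inter>) (map set S))"
  unfolding polytime_computable_on_def
proof (intro exI conjI ballI allI impI)
  show "turing_machine 6 6 seq_machine" by (rule turing_machine_seq_machine)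
next
  fix x :: "('a graph \<times> 'a \<times> 'a) \<times> 'a list list" and l w
  assume x: "x \<in> path_seq_inputs" and rep: "rep_instance_path_seq l x w"
  obtain G s t S where IS: "x = ((G, s, t), S)" by (metis prod.collapse)
  have simple: "simple_graph G" and "gdist G s t \<noteq> \<infinity>"
    and walk: "\<exists>P Q. S \<in> walks (spr_graph G s t) P Q"
    using x by (auto simp: IS path_seq_inputs_def instances_def shortest_reconf_seqs_def
       shortest_def reconf_seqs_def)
  then obtain k where "gdist G s t = enat k" by auto
  then interpret geodesics G s t k using simple by unfold_locales
  have SP: "P \<in> SP" if "P \<in> set S" for P
    using walk that by (auto simp: walks_def spr_graph_def)
  obtain P0 S' where S: "S = P0 # S'" using walk by (cases S) (auto simp: walks_def)
  obtain w' where w': "rep_instance l (G, s, t) w'" "w = w' @ enc_lists (map (map l) S)"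
    using rep by (auto simp: rep_instance_path_seq_def IS)
  have inj: "inj_on l (verts G)" using w'(1) by (simp add: rep_instance_def)
  have verts: "set P \<subseteq> verts G" if "P \<in> set S" for P
    using SP[OF that] by (simp add: SP_iff walks_def)
  have len: "length P = Suc k" if "P \<in> set S" for P using SP[OF that] by (simp add: SP_iff)
  have "interleave common (map (map l) S) = map (map l) (interleave common S)"
    using len verts inj
    by (intro interleave_map common_map) (auto intro: inj_on_subset)
  moreover have "list_all2 (\<lambda>xs A. distinct xs \<and> set xs = A) (interleave common S)
      (interleave (\<inter>) (map set S))"
    using SP SP_distinct distinct_common set_common by (intro list_all2_interleave) auto
  ultimately have "rep_set_seq l (interleave (\<inter>) (map set S)) (enc_lists (interleave common (map (map l) S)))"
    unfolding rep_set_seq_def by auto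
  then show "rep_set_seq l (case x of (I, S) \<Rightarrow> interleave (\<inter>) (map set S))
      (enc_lists (interleave common (map (map l) (snd x))))"
    by (simp add: IS)
  have "outputs_within 6 seq_machine w (enc_lists (interleave common (map (map l) S)))
    (1 + 9 * length w)"
    unfolding w'(2) S list.map using len by (intro seq_machine_correct[OF w'(1)]) (auto simp: S)
  then show "outputs_within 6 seq_machine w (enc_lists (interleave common (map (map l) (snd x))))
     (poly [:1, 9:] (length w))"
    by (simp add: IS mult.commute)
qed simp

section \<open>Token sliding, jumping, addition and removal\<close>

text \<open>Edges are unordered, so each adjacency below has to allow the move in either
  direction.\<close>

lemma doubleton_in_pairs: "{a, b} \<in> {{x, y} | x y. r x y} \<longleftrightarrow> r a b \<or> r b a"
  unfolding mem_Collect_eq doubleton_eq_iff by blast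

lemma adj_ts: "adj (ts_graph H) A B \<longleftrightarrow> indep_set H A \<and> indep_set H B \<and>
    ((\<exists>u \<in> A. \<exists>v \<in> verts H - A. adj H u v \<and> B = insert v (A - {u})) \<or>
     (\<exists>u \<in> B. \<exists>v \<in> verts H - B. adj H u v \<and> A = insert v (B - {u})))"
  unfolding adj_def[of "ts_graph H"]
  unfolding ts_graph_def graph.select_convs doubleton_in_pairs by blast

lemma adj_tj: "adj (tj_graph H) A B \<longleftrightarrow> indep_set H A \<and> indep_set H B \<and>
    ((\<exists>u \<in> A. \<exists>v \<in> verts H - A. B = insert v (A - {u})) \<or>
     (\<exists>u \<in> B. \<exists>v \<in> verts H - B. A = insert v (B - {u})))"
  unfolding adj_def[of "tj_graph H"]
  unfolding tj_graph_def graph.select_convs doubleton_in_pairs by blast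

lemma seq_len_map: "seq_len (map f xs) = seq_len xs"
  by (simp add: seq_len_def)

context geodesics begin

abbreviation "R \<equiv> spr_graph G s t"

lemma verts_R: "verts R = SP"
  by (simp add: spr_graph_def)

lemma adj_R:
  assumes "P \<in> SP" "Q \<in> SP"
  shows "adj R P Q \<longleftrightarrow> card {i. i \<le> k \<and> P ! i \<noteq> Q ! i} = 1"
proof -
  have "length P = Suc k" "length Q = Suc k" using assms SP_iff by auto
  then have *: "{i. i < length P \<and> P ! i \<noteq> Q ! i} = {i. i \<le> k \<and> P ! i \<noteq> Q ! i}"
    "{i. i < length Q \<and> Q ! i \<noteq> P ! i} = {i. i \<le> k \<and> P ! i \<noteq> Q ! i}"
    by auto
  have "adj R P Q \<longleftrightarrow> card {i. i < length P \<and> P ! i \<noteq> Q ! i} = 1 \<or> card {i. i < length Q \<and> Q ! i \<noteq> P ! i} = 1"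
    using assms \<open>length P = Suc k\<close> \<open>length Q = Suc k\<close>
    unfolding adj_def[of R]
    unfolding spr_graph_def graph.select_convs doubleton_in_pairs by simp
  then show ?thesis unfolding * by simp
qed

text \<open>The new vertex has the position of the old one, so both lie in one layer and are joined
  in \<open>G'\<close>: the exchange is a slide. It is not on \<open>P\<close> elsewhere, by
  uniqueness of positions.\<close>

lemma adj_R_exchange:
  assumes PQ: "P \<in> SP" "Q \<in> SP" and adj: "adj R P Q"
  obtains u v where "u \<in> set P" "v \<in> verts G' - set P" "adj G' u v" "set Q = insert v (set P - {u})"
proof -
  obtain i where i: "{i. i \<le> k \<and> P ! i \<noteq> Q ! i} = {i}"
    using adj adj_R[OF PQ] by (auto simp: card_1_singleton_iff)
  then have ik: "i \<le> k" "P ! i \<noteq> Q ! i" by auto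
  have same: "P ! j = Q ! j" if "j \<le> k" "j \<noteq> i" for j using i that by auto
  have new: "Q ! i \<notin> set P"
  proof
    assume "Q ! i \<in> set P"
    then obtain j where "j \<le> k" "Q ! i = P ! j" using SP_nthE[OF PQ(1)] by metis
    then show False using position_unique[OF PQ(2,1) ik(1)] ik(2) by metis
  qed
  have "P ! j \<noteq> P ! i" if "j \<le> k" "j \<noteq> i" for j
    using position_unique[OF PQ(1,1) that(1) ik(1)] that(2) by blast
  then have "set Q = insert (Q ! i) (set P - {P ! i})"
    unfolding set_SP[OF PQ(1)] set_SP[OF PQ(2)] using same ik(1) by auto (metis atMost_iff image_eqI)
  moreover have "adj G' (P ! i) (Q ! i)" unfolding adj_G' using ik nth_in_L PQ by blast
  moreover have "Q ! i \<in> verts G' - set P" using new ik(1) nth_in_L[OF PQ(2)] verts_G' by blast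
  moreover have "P ! i \<in> set P" using SP_nth_mem PQ ik by blast
  ultimately show ?thesis using that by blast
qed

lemma exchange_adj_R:
  assumes PQ: "P \<in> SP" "Q \<in> SP" and uv: "u \<in> set P" "v \<notin> set P" "set Q = insert v (set P - {u})"
  shows "adj R P Q"
proof -
  obtain i where i: "i \<le> k" "u = P ! i" using SP_nthE[OF PQ(1) uv(1)] .
  obtain m where m: "m \<le> k" "v = Q ! m" using SP_nthE[OF PQ(2), of v] uv(3) by blast
  have shared: "Q ! j = P ! j \<and> j \<noteq> i" if "j \<le> k" "j \<noteq> m" for j
  proof -
    have "Q ! j \<noteq> v" using position_unique[OF PQ(2,2) that(1) m(1)] m(2) that(2) by blast
    moreover have "Q ! j \<in> set Q" using SP_nth_mem PQ(2) that(1) by blast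
    ultimately have "Q ! j \<in> set P" "Q ! j \<noteq> u" using uv(3) by auto
    then show ?thesis using SP_nthE[OF PQ(1)] position_unique[OF PQ(2,1) that(1)] i(2) by metis
  qed
  \<comment> \<open>Otherwise \<open>shared\<close> at \<open>j = i\<close> would give
    \<open>i \<noteq> i\<close>: the position freed by \<open>u\<close> can only be filled by
    \<open>v\<close>.\<close>
  then have "m = i" using i(1) by metis
  moreover have "P ! m \<noteq> Q ! m" using m uv(2) SP_nth_mem[OF PQ(1) m(1)] by metis
  ultimately have "{j. j \<le> k \<and> P ! j \<noteq> Q ! j} = {i}" using shared m(1) by fastforce
  then show ?thesis using adj_R[OF PQ] by simp
qed

lemma adj_R_sym: "adj R P Q \<longleftrightarrow> adj R Q P"
  by (rule adj_sym)

lemma adj_ts_tj: "adj (ts_graph G') A B \<Longrightarrow> adj (tj_graph G') A B"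
  unfolding adj_ts adj_tj by blast

lemma adj_tj_indep: "adj (tj_graph G') A B \<Longrightarrow> indep_set G' A \<and> indep_set G' B \<and> card A = card B"
proof -
  assume "adj (tj_graph G') A B"
  then have *: "indep_set G' A" "indep_set G' B"
    "(\<exists>u\<in>A. \<exists>v\<in>verts G' - A. B = insert v (A - {u})) \<or> (\<exists>u\<in>B. \<exists>v\<in>verts G' - B. A = insert v (B - {u}))"
    unfolding adj_tj by blast+
  have card: "card (insert v (C - {u})) = card C" if "u \<in> C" "v \<notin> C" "finite C" for u v :: 'a and C
    using that card_Suc_Diff1[of C u] by (simp add: card_insert_if)
  show ?thesis using * card lev_inj(3) by (metis DiffD2)
qed

text \<open>A cycle of implications: a slide is a jump, a jump changes one position of the path, and
  such a change is a slide.\<close>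

lemma adj_tj_SP:
  assumes PQ: "P \<in> SP" "Q \<in> SP"
  shows "adj (tj_graph G') (set P) (set Q) \<longleftrightarrow> adj R P Q"
    "adj (ts_graph G') (set P) (set Q) \<longleftrightarrow> adj R P Q"
proof -
  have "adj R P Q" if "adj (tj_graph G') (set P) (set Q)"
  proof -
    have "(\<exists>u\<in>set P. \<exists>v\<in>verts G' - set P. set Q = insert v (set P - {u})) \<or>
       (\<exists>u\<in>set Q. \<exists>v\<in>verts G' - set Q. set P = insert v (set Q - {u}))"
      using that unfolding adj_tj by blast
    then show ?thesis
      using exchange_adj_R[OF PQ] exchange_adj_R[OF PQ(2,1)] adj_R_sym by blast
  qed
  moreover have "adj (ts_graph G') (set P) (set Q)" if "adj R P Q"
    using adj_R_exchange[OF PQ that] indep_SP PQ unfolding adj_ts by metis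
  ultimately show "adj (tj_graph G') (set P) (set Q) \<longleftrightarrow> adj R P Q"
    "adj (ts_graph G') (set P) (set Q) \<longleftrightarrow> adj R P Q"
    using adj_ts_tj by blast+
qed

text \<open>A jump preserves the size \<open>k + 1\<close>, and independent sets of that size are
  vertex sets of shortest paths.\<close>

lemma adj_tj_closed:
  assumes "P \<in> SP" "adj (tj_graph G') (set P) B"
  shows "B \<in> set ` SP"
  using adj_tj_indep[OF assms(2)] card_SP[OF assms(1)] indep_is_SP[of B] by force

lemma scaling_bij_tj:
  assumes "P \<in> SP" "Q \<in> SP"
  shows "scaling_bij 1 (map set) (shortest_reconf_seqs R P Q)
    (shortest_reconf_seqs (tj_graph G') (set P) (set Q))"
  using assms inj_SP indep_SP adj_tj_SP adj_tj_closed
  by (intro scaling_bij_embedding) (auto simp: verts_R tj_graph_def)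

lemma scaling_bij_ts:
  assumes "P \<in> SP" "Q \<in> SP"
  shows "scaling_bij 1 (map set) (shortest_reconf_seqs R P Q)
    (shortest_reconf_seqs (ts_graph G') (set P) (set Q))"
  using assms inj_SP indep_SP adj_tj_SP adj_tj_closed adj_ts_tj
  by (intro scaling_bij_embedding) (auto simp: verts_R ts_graph_def)

section \<open>Token addition and removal\<close>

abbreviation "TAR \<equiv> tar_graph (k + 1) G'"

lemma verts_TAR: "verts TAR = {A. indep_set G' A \<and> k \<le> card A}"
  by (simp add: tar_graph_def Let_def)

lemma SP_verts_TAR: "P \<in> SP \<Longrightarrow> set P \<in> verts TAR"
  unfolding verts_TAR using indep_SP card_SP by simp

lemma adj_TAR: "adj TAR A B \<longleftrightarrow> A \<in> verts TAR \<and> B \<in> verts TAR \<and>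
    ((\<exists>v \<in> verts G' - A. B = insert v A) \<or> (\<exists>v \<in> verts G' - B. A = insert v B))"
  unfolding adj_def[of TAR]
  unfolding tar_graph_def Let_def graph.select_convs doubleton_in_pairs by blast

text \<open>An addition would give an independent set of size \<open>k + 2\<close>, more than there
  are layers.\<close>

lemma adj_TAR_remove:
  assumes A: "card A = k + 1" and adj: "adj TAR A B"
  obtains u where "u \<in> A" "B = A - {u}" "card B = k"
proof -
  have fin: "finite A" "finite B" and cB: "card B \<le> k + 1"
    using adj lev_inj(3) card_indep_le unfolding adj_TAR verts_TAR by auto
  from adj consider v where "v \<notin> A" "B = insert v A" | v where "v \<notin> B" "A = insert v B"
    unfolding adj_TAR by blast
  then show ?thesis
  proof cases
    case 1
    then show ?thesis using fin cB A by simp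
  next
    case 2
    then have "v \<in> A" "B = A - {v}" by auto
    moreover have "card B = k" using 2 fin A by simp
    ultimately show ?thesis by (rule that)
  qed
qed

text \<open>A removal would go below the least admissible size \<open>k\<close>.\<close>

lemma adj_TAR_add:
  assumes B: "card B = k" and adj: "adj TAR B C"
  obtains v where "v \<in> verts G' - B" "C = insert v B" "indep_set G' C" "card C = k + 1"
proof -
  have fin: "finite B" "finite C" and cC: "k \<le> card C" and C: "indep_set G' C"
    using adj lev_inj(3) unfolding adj_TAR verts_TAR by auto
  from adj consider v where "v \<in> verts G' - B" "C = insert v B" | v where "v \<notin> C" "B = insert v C"
    unfolding adj_TAR by blast
  then show ?thesis
  proof cases
    case 1
    then have "card C = k + 1" using fin B by simp
    with 1 C show ?thesis by (intro that)
  next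
    case 2
    then show ?thesis using fin cC B by simp
  qed
qed

lemma interleave_walk:
  assumes "S \<in> walks R P Q"
  shows "interleave (\<inter>) (map set S) \<in> walks TAR (set P) (set Q)"
  using assms
proof (induction S arbitrary: P rule: induct_list012)
  case 1
  then show ?case by (simp add: walks_def)
next
  case (2 P')
  then show ?case using SP_verts_TAR by (auto simp: walks_Cons verts_R)
next
  case (3 P' P2 S)
  then have P: "P' = P" "P \<in> SP" "adj R P P2" and w: "P2 # S \<in> walks R P2 Q"
    by (auto simp: walks_Cons verts_R)
  then have P2: "P2 \<in> SP" by (auto simp: walks_def verts_R)
  obtain u v where "u \<in> set P" "v \<in> verts G' - set P" "adj G' u v" "set P2 = insert v (set P - {u})"
    by (rule adj_R_exchange[OF P(2) P2 P(3)])
  then have uv: "u \<in> set P" "v \<in> verts G' - set P" "set P2 = insert v (set P - {u})" by simp_all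
  let ?I = "set P \<inter> set P2"
  have I: "?I = set P - {u}" using uv by auto
  have cI: "card ?I = k" unfolding I using uv(1) card_SP[OF P(2)] by simp
  have indI: "indep_set G' ?I" using indep_SP[OF P(2)] by (auto simp: indep_set_def)
  have V: "set P \<in> verts TAR" "set P2 \<in> verts TAR" "?I \<in> verts TAR"
    using SP_verts_TAR P(2) P2 cI indI unfolding verts_TAR by auto
  have "set P = insert u ?I" "u \<notin> ?I" "u \<in> verts G'" "set P2 = insert v ?I" "v \<notin> ?I"
    using I uv indep_SP[OF P(2)] by (auto simp: indep_set_def)
  then have adj: "adj TAR (set P) ?I" "adj TAR ?I (set P2)"
    using V uv(2) unfolding adj_TAR by blast+
  obtain ys where ys: "interleave (\<inter>) (map set (P2 # S)) = set P2 # ys"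
    using interleave_Cons[of "(\<inter>)" "set P2" "map set S"] by auto
  have "set P2 # ys \<in> walks TAR (set P2) (set Q)" using "3.IH"(2)[OF w] ys by simp
  then show ?case using ys adj V by (simp add: P walks_Cons[of "set P"] walks_Cons[of ?I])
qed

text \<open>Two steps are peeled off at a time, leading through a set \<open>B\<close> of size
  \<open>k\<close> to the vertex set \<open>C\<close> of a path. The alternative in the conclusion
  is the one required by \<open>scaling_bij_shortest\<close>.\<close>

lemma walk_TAR_interleave:
  assumes "w \<in> walks TAR (set P) (set Q)" "P \<in> SP" "Q \<in> SP"
  shows "\<exists>S \<in> walks R P Q. interleave (\<inter>) (map set S) = w \<or> 2 * seq_len S < seq_len w"
  using assms
proof (induction "length w" arbitrary: w P rule: less_induct)
  case less
  note P = less.prems(2) and Q = less.prems(3)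
  obtain w1 where w: "w = set P # w1" using less.prems(1) by (cases w) (auto simp: walks_def)
  show ?case
  proof (cases w1)
    case Nil
    then have "set P = set Q" using less.prems(1) w by (simp add: walks_Cons)
    then have "P = Q" using inj_SP P Q by (simp add: inj_on_eq_iff)
    then show ?thesis using P Nil w by (intro bexI[of _ "[P]"]) (auto simp: walks_Cons verts_R)
  next
    case (Cons B w2)
    then have adjB: "adj TAR (set P) B" and wB: "B # w2 \<in> walks TAR B (set Q)"
      using less.prems(1) w by (auto simp: walks_Cons)
    obtain u where u: "u \<in> set P" "B = set P - {u}" "card B = k"
      using adj_TAR_remove[OF card_SP[OF P] adjB] .
    \<comment> \<open>The walk cannot end at \<open>B\<close>, which has one vertex too few.\<close>
    have "w2 \<noteq> []"
    proof
      assume "w2 = []"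
      then have "B = set Q" using wB by (simp add: walks_Cons)
      then show False using u(3) card_SP[OF Q] by simp
    qed
    then obtain C w3 where w2: "w2 = C # w3" by (cases w2) auto
    then have adjC: "adj TAR B C" and wC: "w2 \<in> walks TAR C (set Q)"
      using wB by (auto simp: walks_Cons)
    obtain v where v: "v \<in> verts G' - B" "C = insert v B" "indep_set G' C" "card C = k + 1"
      using adj_TAR_add[OF u(3) adjC] .
    obtain P2 where P2: "P2 \<in> SP" "set P2 = C" using indep_is_SP[OF v(3,4)] by blast
    obtain S where S: "S \<in> walks R P2 Q" "interleave (\<inter>) (map set S) = w2 \<or> 2 * seq_len S < seq_len w2"
      using less.hyps[of w2 P2] wC P2 Q w Cons by auto
    have len: "seq_len w = 2 + seq_len w2" using w Cons w2 by (simp add: seq_len_def)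
    have S_le: "2 * seq_len S \<le> seq_len w2"
      using S(2) seq_len_interleave[of "(\<inter>)" "map set S"] by (auto simp: seq_len_def)
    show ?thesis
    proof (cases "C = set P")
      \<comment> \<open>The removed vertex was put back. Dropping both steps leaves a walk for which
        \<open>2 * seq_len S\<close> is at least two below the length of \<open>w\<close>, which
        gives the strict alternative.\<close>
      case True
      then have "P2 = P" using P2 P inj_SP by (simp add: inj_on_eq_iff)
      then show ?thesis using S(1) S_le len by (intro bexI[of _ S]) auto
    next
      case False
      then have vP: "v \<notin> set P" using u v by auto
      then have adj: "adj R P P2" using exchange_adj_R[OF P P2(1) u(1) vP] P2(2) v(2) u(2) by blast
      obtain S' where S': "S = P2 # S'" using S(1) by (cases S) (auto simp: walks_def)
      have walk: "P # S \<in> walks R P Q" using S(1) S' adj P by (auto simp: walks_Cons[of P] verts_R)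
      have "set P \<inter> C = B" using u v vP by auto
      then have "interleave (\<inter>) (map set (P # S)) = set P # B # interleave (\<inter>) (map set S)"
        by (simp add: S' P2)
      moreover have "seq_len (P # S) = Suc (seq_len S)" by (simp add: seq_len_def S')
      ultimately have "interleave (\<inter>) (map set (P # S)) = w \<or> 2 * seq_len (P # S) < seq_len w"
        using S(2) len w Cons by auto
      then show ?thesis using walk by blast
    qed
  qed
qed

lemma scaling_bij_tar:
  assumes P: "P \<in> SP" and Q: "Q \<in> SP"
  shows "scaling_bij 2 (\<lambda>S. interleave (\<inter>) (map set S)) (shortest_reconf_seqs R P Q)
    (shortest_reconf_seqs TAR (set P) (set Q))"
  unfolding shortest_reconf_seqs_def reconf_seqs_def
proof (rule scaling_bij_shortest)
  have "inj_on (map set) (lists SP)" by (rule inj_on_mapI[OF inj_on_subset[OF inj_SP]]) auto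
  moreover have "walks R P Q \<subseteq> lists SP" using verts_R by (auto simp: walks_def)
  ultimately show "inj_on (\<lambda>S. interleave (\<inter>) (map set S)) (walks R P Q)"
    unfolding inj_on_def interleave_inject by blast
qed (use interleave_walk walk_TAR_interleave P Q in \<open>auto simp: seq_len_interleave seq_len_map\<close>)

end

theorem theorem4:
  "\<exists>(\<phi> :: 'a graph \<times> 'a \<times> 'a \<Rightarrow> 'a list \<Rightarrow> 'a set)
    (\<psi> :: 'a graph \<times> 'a \<times> 'a \<Rightarrow> 'a list list \<Rightarrow> 'a set list).
     polytime_computable_on path_inputs rep_instance_path rep_set (\<lambda>(I, P). \<phi> I P) \<and>
     polytime_computable_on path_seq_inputs rep_instance_path_seq rep_set_seq (\<lambda>(I, S). \<psi> I S) \<and>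
     (\<forall>(G :: 'a graph) s t k.
        simple_graph G \<and> s \<in> verts G \<and> t \<in> verts G \<and> gdist G s t = enat k \<longrightarrow>
        (let G' = layered_cograph G s t k; f = \<phi> (G, s, t) in
           bij_betw f (shortest_paths G s t) {A. indep_set G' A \<and> card A = k + 1} \<and>
           (\<forall>P \<in> shortest_paths G s t. \<forall>Q \<in> shortest_paths G s t.
              scaling_bij 1 (map f)
                (shortest_reconf_seqs (spr_graph G s t) P Q)
                (shortest_reconf_seqs (ts_graph G') (f P) (f Q)) \<and>
              scaling_bij 1 (map f)
                (shortest_reconf_seqs (spr_graph G s t) P Q)
                (shortest_reconf_seqs (tj_graph G') (f P) (f Q)) \<and>
              scaling_bij 2 (\<psi> (G, s, t))
                (shortest_reconf_seqs (spr_graph G s t) P Q)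
                (shortest_reconf_seqs (tar_graph (k + 1) G') (f P) (f Q)))))"
  unfolding Let_def
proof (intro exI[of _ "\<lambda>I. set"] exI[of _ "\<lambda>I S. interleave (\<inter>) (map set S)"] conjI allI impI ballI)
  fix G :: "'a graph" and s t k
  assume "simple_graph G \<and> s \<in> verts G \<and> t \<in> verts G \<and> gdist G s t = enat k"
  then interpret geodesics G s t k by unfold_locales auto
  show "bij_betw set SP {A. indep_set G' A \<and> card A = k + 1}" by (rule bij_SP)
  fix P Q assume PQ: "P \<in> SP" "Q \<in> SP"
  show "scaling_bij 1 (map set) (shortest_reconf_seqs R P Q)
      (shortest_reconf_seqs (ts_graph G') (set P) (set Q))"
    using PQ by (rule scaling_bij_ts)
  show "scaling_bij 1 (map set) (shortest_reconf_seqs R P Q)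
      (shortest_reconf_seqs (tj_graph G') (set P) (set Q))"
    using PQ by (rule scaling_bij_tj)
  show "scaling_bij 2 (\<lambda>S. interleave (\<inter>) (map set S)) (shortest_reconf_seqs R P Q)
      (shortest_reconf_seqs TAR (set P) (set Q))"
    using PQ by (rule scaling_bij_tar)
qed (rule polytime_vertex_set polytime_interleaved_sets)+

end
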